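(* Let $R,T,D>0$ and $\beta:=\frac{R^2}{4TD}$. Let $N\in\mathbb{N}$, $N\ge 1$, and let $0\le r_1<r_2<\dots<r_N$. Let $g:[0,\infty)\to\{0,1\}$ be the compactly supported function with jumps at the radii $r_j$ given by $g=1$ on the alternating intervals $(r_{N-1},r_N),(r_{N-3},r_{N-2}),\dots$ (with the innermost interval being $[0,r_1)$ if $N$ is odd and $(r_1,r_2)$ if $N$ is even) and $g=0$ elsewhere. Let the scaled initial condition be the radially symmetric $\{0,1\}$-valued function $v_0(z)=g(\|z\|)$, $z\in\mathbb{R}^2$, i.e. $u_0(x)=v_0(x/R)$. Then the sensitivity $S_{int}$ associated with $u_0$ is given by $$S_{int}=\frac{T^3}{R^2}\,32\pi\beta^3\sum_{j,k=1}^N(-1)^{k+j}\,k(r_j,r_k),$$ where, for $r,s\ge 0$, $$k(r,s)=\int_0^1 q\int_\beta^\infty e^{-\rho(q^2+r^2+q^2+s^2)}\{rI_0(2qr\rho)-qI_1(2qr\rho)\}\{sI_0(2qs\rho)-qI_1(2qs\rho)\}\,rs\,d\rho\,dq.$$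
   Context: For a bounded, compactly supported initial condition $u_0$ on $\mathbb{R}^2$ and $D>0$, let $u$ be the free-space solution of the heat equation $\partial_t u=D\Delta u$ on $\mathbb{R}^2\times[0,T]$ with $u(\cdot,0)=u_0$, i.e. for $t>0$ $$u(x,t)=\int_{\mathbb{R}^2}G(x-y,tD)u_0(y)\,dy,\qquad G(z,t)=\frac{1}{4\pi t}e^{-\|z\|^2/(4t)}.$$ $\frac{\partial u}{\partial D}(x,t)$ denotes the derivative of $u(x,t)$ with respect to the parameter $D$, with $u_0$ held fixed. The sensitivity is $$S_{int}:=\int_{\|x\|\le R}\int_0^T\left|\frac{\partial u}{\partial D}(x,t)\right|^2\,dt\,dx.$$ $I_0,I_1$ are the modified Bessel functions of the first kind. The values of $g$ at the jump points are immaterial. In the formula, the symbol $k$ is used both for a summation index and for the kernel function $k(\cdot,\cdot)$. *)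

theory Defs
  imports "HOL-Analysis.Analysis"
begin

definition heat_kernel :: "real^2 \<Rightarrow> real \<Rightarrow> real" where
  "heat_kernel z t = 1 / (4 * pi * t) * exp (- (norm z)\<^sup>2 / (4 * t))"

definition heat_solution :: "(real^2 \<Rightarrow> real) \<Rightarrow> real \<Rightarrow> real^2 \<Rightarrow> real \<Rightarrow> real" where
  "heat_solution u0 D x t =
     (if t = 0 then u0 x else (\<integral>y. heat_kernel (x - y) (t * D) * u0 y \<partial>lborel))"

definition sensitivity :: "(real^2 \<Rightarrow> real) \<Rightarrow> real \<Rightarrow> real \<Rightarrow> real \<Rightarrow> real" where
  "sensitivity u0 D R T =
     (LINT x:cball 0 R|lborel. LINT t:{0..T}|lborel.
        \<bar>deriv (\<lambda>D'. heat_solution u0 D' x t) D\<bar>\<^sup>2)"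

definition modified_bessel_I :: "nat \<Rightarrow> real \<Rightarrow> real" where
  "modified_bessel_I n x = (\<Sum>m. (x / 2) ^ (2 * m + n) / (fact m * fact (m + n)))"

definition sensitivity_kernel :: "real \<Rightarrow> real \<Rightarrow> real \<Rightarrow> real" where
  "sensitivity_kernel \<beta> r s =
     (LINT q:{0..1}|lborel. q * (LINT \<rho>:{\<beta>..}|lborel.
        exp (- \<rho> * (q\<^sup>2 + r\<^sup>2 + q\<^sup>2 + s\<^sup>2))
        * (r * modified_bessel_I 0 (2 * q * r * \<rho>) - q * modified_bessel_I 1 (2 * q * r * \<rho>))
        * (s * modified_bessel_I 0 (2 * q * s * \<rho>) - q * modified_bessel_I 1 (2 * q * s * \<rho>))
        * r * s))"

text \<open>The radii are \<open>r 1, \<dots>, r N\<close>; \<open>r 0\<close> is never used. The condition \<open>even (N - j)\<close>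
  selects the intervals ending at \<open>r N\<close>, \<open>r (N - 2)\<close>, and so on.\<close>

definition alternating_intervals :: "nat \<Rightarrow> (nat \<Rightarrow> real) \<Rightarrow> real set" where
  "alternating_intervals N r =
     (\<Union>j\<in>{j \<in> {1..N}. even (N - j)}. if j = 1 then {0..<r 1} else {r (j - 1)<..<r j})"

text \<open>At the jump radii the profile may take either of the values 0 and 1.\<close>

definition alternating_profile :: "nat \<Rightarrow> (nat \<Rightarrow> real) \<Rightarrow> (real \<Rightarrow> real) \<Rightarrow> bool" where
  "alternating_profile N r g \<longleftrightarrow>
     (\<forall>s\<ge>0. g s \<in> {0, 1}) \<and>
     (\<forall>s\<ge>0. s \<notin> r ` {1..N} \<longrightarrow> g s = (if s \<in> alternating_intervals N r then 1 else 0))"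

end

theory Submission
  imports
    Defs
    "HOL-Probability.Distributions"
    "HOL-Complex_Analysis.Cauchy_Integral_Formula"
    "HOL-Real_Asymp.Real_Asymp"
begin

text \<open>
  Up to a null set the initial datum is an alternating sum of indicators of discs. Write
  \<open>\<rho> = 1 / (4 t D)\<close>. Expanding \<open>exp (2 \<rho> x \<bullet> y)\<close> in powers of \<open>x \<bullet> y\<close>, whose even powers
  are homogeneous weights with radial averages computable from one Gaussian integral, turns the
  heat solution of the disc of radius \<open>a\<close> into the integral over \<open>s \<in> [0, a]\<close> of
  \<open>2 \<rho> s exp (- \<rho> (q\<^sup>2 + s\<^sup>2)) I\<^sub>0 (2 q s \<rho>)\<close>, where \<open>q = norm x\<close>. By the Bessel identities
  \<open>I\<^sub>0' = I\<^sub>1\<close> and \<open>(x I\<^sub>1)' = x I\<^sub>0\<close> the \<open>\<rho>\<close>-derivative of this integrand is an exact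
  \<open>s\<close>-derivative, so only a boundary flux at \<open>s = a\<close> survives. Squaring the alternating sum of
  fluxes and substituting \<open>\<rho>\<close> for \<open>t\<close> gives the double sum of kernels. The sum may be
  integrated termwise because each flux is square integrable in \<open>\<rho>\<close>, uniformly in \<open>q\<close>: from
  \<open>0 \<le> x (I\<^sub>0 - I\<^sub>1) \<le> exp x / 2\<close> it is at most
  \<open>(a \<bar>a - q\<bar> + 1 / (4 \<rho>)) exp (- \<rho> (a - q)\<^sup>2)\<close>.
\<close>

section \<open>Modified Bessel functions\<close>

lemma summable_bessel_series:
  fixes y :: real
  shows "summable (\<lambda>m. y ^ m / (fact m * fact (m + n)))"
proof (rule summable_comparison_test')
  show "summable (\<lambda>m. inverse (fact m) * \<bar>y\<bar> ^ m)"
    by (rule summable_exp)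
  show "norm (y ^ m / (fact m * fact (m + n))) \<le> inverse (fact m) * \<bar>y\<bar> ^ m" if "m \<ge> 0" for m
  proof -
    have "\<bar>y\<bar> ^ m / fact (m + n) \<le> \<bar>y\<bar> ^ m / 1"
      by (intro divide_left_mono) (auto simp: fact_ge_1)
    then show ?thesis
      by (simp add: abs_mult power_abs divide_simps)
  qed
qed

lemma bessel_term_eq:
  fixes x :: real
  shows "(x / 2) ^ (2 * m + n) / (fact m * fact (m + n))
    = (x / 2) ^ n * (((x / 2)\<^sup>2) ^ m / (fact m * fact (m + n)))"
  by (simp add: power_add power_mult)

lemma modified_bessel_I_summable:
  fixes x :: real
  shows "summable (\<lambda>m. (x / 2) ^ (2 * m + n) / (fact m * fact (m + n)))"
  unfolding bessel_term_eq by (intro summable_mult summable_bessel_series)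

lemma modified_bessel_I_eq:
  "modified_bessel_I n x = (x / 2) ^ n * (\<Sum>m. ((x / 2)\<^sup>2) ^ m / (fact m * fact (m + n)))"
  unfolding modified_bessel_I_def bessel_term_eq
  by (intro suminf_mult summable_bessel_series)

lemma modified_bessel_I_nonneg: "0 \<le> x \<Longrightarrow> 0 \<le> modified_bessel_I n x"
  unfolding modified_bessel_I_def
  by (intro suminf_nonneg modified_bessel_I_summable) auto

lemma modified_bessel_I0_at_0: "modified_bessel_I 0 0 = 1"
proof -
  have "(\<Sum>m. (0 / 2 :: real) ^ (2 * m + 0) / (fact m * fact (m + 0)))
      = (\<Sum>m\<in>{0}. (0 / 2 :: real) ^ (2 * m + 0) / (fact m * fact (m + 0)))"
    by (rule suminf_finite) auto
  then show ?thesis by (simp add: modified_bessel_I_def)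
qed

lemma DERIV_powser_real:
  fixes c d :: "nat \<Rightarrow> real"
  assumes c: "\<And>y. summable (\<lambda>m. c m * y ^ m)" and d: "\<And>m. real (Suc m) * c (Suc m) = d m"
  shows "((\<lambda>y. \<Sum>m. c m * y ^ m) has_real_derivative (\<Sum>m. d m * y ^ m)) (at y)"
proof -
  have "diffs c = d" using d by (auto simp: diffs_def fun_eq_iff)
  with termdiffs_strong[of c "\<bar>y\<bar> + 1" y] c show ?thesis by simp
qed

text \<open>\<open>I\<^sub>0\<close> is a power series in \<open>y = (x / 2)\<^sup>2\<close>. Its
  \<open>y\<close>-derivative is the series of \<open>I\<^sub>1\<close> stripped of the prefactor
  \<open>x / 2\<close>, and the chain rule supplies exactly that factor.\<close>

lemma DERIV_modified_bessel_I0: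
  "(modified_bessel_I 0 has_real_derivative modified_bessel_I 1 x) (at x)"
proof -
  define c where "c m = 1 / (fact m * fact m :: real)" for m
  define d where "d m = 1 / (fact m * fact (m + 1) :: real)" for m
  have 1: "((\<lambda>y. \<Sum>m. c m * y ^ m) has_real_derivative (\<Sum>m. d m * y ^ m)) (at y)" for y
  proof (rule DERIV_powser_real)
    show "summable (\<lambda>m. c m * y ^ m)" for y
      using summable_bessel_series[of y 0] by (simp add: c_def)
    show "real (Suc m) * c (Suc m) = d m" for m
      unfolding c_def d_def by (simp add: divide_simps)
  qed
  have 2: "modified_bessel_I 0 = (\<lambda>x. \<Sum>m. c m * ((x / 2)\<^sup>2) ^ m)"
    unfolding modified_bessel_I_def c_def by (simp add: power_mult)
  have 3: "modified_bessel_I 1 x = (\<Sum>m. d m * ((x / 2)\<^sup>2) ^ m) * (x / 2)"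
    unfolding modified_bessel_I_eq d_def by simp
  show ?thesis unfolding 2 3
    by (rule DERIV_chain2[OF 1]) (auto intro!: derivative_eq_intros)
qed

text \<open>\<open>x I\<^sub>1\<close> is twice a power series in
  \<open>y = (x / 2)\<^sup>2\<close>. Differentiating in \<open>y\<close> turns its coefficients
  into those of \<open>I\<^sub>0\<close>; the outer 2 and the inner derivative \<open>x / 2\<close>
  combine to \<open>x\<close>.\<close>

lemma DERIV_mult_modified_bessel_I1:
  "((\<lambda>x. x * modified_bessel_I 1 x) has_real_derivative x * modified_bessel_I 0 x) (at x)"
proof -
  \<comment> \<open>This series has no constant term; the case split also keeps the truncated
    \<open>m - 1\<close> away from \<open>m = 0\<close>.\<close>
  define c where "c m = (if m = 0 then 0 else 1 / (fact (m - 1) * fact m :: real))" for m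
  define d where "d m = 1 / (fact m * fact m :: real)" for m
  have Suc: "c (Suc m) * y ^ Suc m = y * (y ^ m / (fact m * fact (m + 1)))" for m y
    by (simp add: c_def)
  have sc: "summable (\<lambda>m. c m * y ^ m)" for y
    unfolding summable_Suc_iff[of "\<lambda>m. c m * y ^ m", symmetric] Suc
    by (intro summable_mult summable_bessel_series)
  have 1: "((\<lambda>y. \<Sum>m. c m * y ^ m) has_real_derivative (\<Sum>m. d m * y ^ m)) (at y)" for y
  proof (rule DERIV_powser_real[OF sc])
    show "real (Suc m) * c (Suc m) = d m" for m
      unfolding c_def d_def by (simp add: divide_simps)
  qed
  have 2: "x * modified_bessel_I 1 x = 2 * (\<Sum>m. c m * ((x / 2)\<^sup>2) ^ m)" for x
  proof -
    have "(\<Sum>m. c m * ((x / 2)\<^sup>2) ^ m) = (\<Sum>m. c (Suc m) * ((x / 2)\<^sup>2) ^ Suc m)"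
      using suminf_split_head[OF sc] by (simp add: c_def)
    also have "\<dots> = (\<Sum>m. (x / 2) * ((x / 2) ^ (2 * m + 1) / (fact m * fact (m + 1))))"
      by (intro suminf_cong) (simp add: c_def power_mult power_add power2_eq_square divide_simps)
    also have "\<dots> = (x / 2) * modified_bessel_I 1 x"
      unfolding modified_bessel_I_def by (intro suminf_mult modified_bessel_I_summable)
    finally show ?thesis by simp
  qed
  have 3: "modified_bessel_I 0 x = (\<Sum>m. d m * ((x / 2)\<^sup>2) ^ m)"
    unfolding modified_bessel_I_def d_def by (simp add: power_mult)
  show ?thesis unfolding 2 3
    by (rule DERIV_cmult[OF DERIV_chain2[OF 1], THEN DERIV_cong])
      (auto intro!: derivative_eq_intros)
qed

lemma isCont_modified_bessel_I:
  "isCont (modified_bessel_I n) x"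
proof -
  define c where "c m = 1 / (fact m * fact (m + n) :: real)" for m
  have "modified_bessel_I n = (\<lambda>x. (x / 2) ^ n * (\<Sum>m. c m * ((x / 2)\<^sup>2) ^ m))"
    by (simp add: fun_eq_iff modified_bessel_I_eq c_def)
  moreover
  have "isCont (\<lambda>y. \<Sum>m. c m * y ^ m) y" for y
    using summable_bessel_series[of "\<bar>y\<bar> + 1" n]
    by (intro isCont_powser[where K = "\<bar>y\<bar> + 1"]) (auto simp: c_def)
  then have "isCont (\<lambda>x. \<Sum>m. c m * ((x / 2)\<^sup>2) ^ m) x"
    by (rule isCont_o2[rotated]) (intro continuous_intros, simp)
  then have "isCont (\<lambda>x. (x / 2) ^ n * (\<Sum>m. c m * ((x / 2)\<^sup>2) ^ m)) x"
    by (intro continuous_intros) auto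
  ultimately show ?thesis by metis
qed

lemma continuous_on_modified_bessel_I [continuous_intros]:
  "continuous_on S f \<Longrightarrow> continuous_on S (\<lambda>x. modified_bessel_I n (f x))"
  by (rule continuous_on_compose2[of UNIV "modified_bessel_I n"])
    (auto simp: isCont_modified_bessel_I continuous_at_imp_continuous_on)

lemma borel_measurable_modified_bessel_I [measurable]:
  "modified_bessel_I n \<in> borel_measurable borel"
  by (intro borel_measurable_continuous_onI continuous_intros)

text \<open>Three monotonicity arguments, each feeding the next. With
  \<open>w = x (I\<^sub>0 - I\<^sub>1)\<close> the derivative of \<open>exp x * w\<close> collapses
  to \<open>exp x * I\<^sub>0\<close>, so \<open>w\<close> is nonnegative. Hence
  \<open>exp (- x) * I\<^sub>0\<close> decreases from 1, so \<open>I\<^sub>0\<close> is at most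
  \<open>exp x\<close>. Then \<open>exp x * w\<close> grows no faster than
  \<open>exp (2 * x) / 2\<close>.\<close>

lemma bessel_diff_bounds:
  assumes "0 \<le> x"
  shows "0 \<le> x * (modified_bessel_I 0 x - modified_bessel_I 1 x)"
    and "modified_bessel_I 0 x \<le> exp x"
    and "x * (modified_bessel_I 0 x - modified_bessel_I 1 x) \<le> exp x / 2"
proof -
  define w where "w x = x * (modified_bessel_I 0 x - modified_bessel_I 1 x)" for x
  have dw: "((\<lambda>x. exp x * w x) has_real_derivative exp x * modified_bessel_I 0 x) (at x)" for x
    unfolding w_def right_diff_distrib
    by (rule derivative_eq_intros DERIV_mult_modified_bessel_I1 DERIV_modified_bessel_I0 refl)+
      (simp add: algebra_simps)
  have w0: "0 \<le> w y" if "0 \<le> y" for y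
  proof -
    have "exp 0 * w 0 \<le> exp y * w y"
      by (rule DERIV_nonneg_imp_nondecreasing[OF that])
        (use dw modified_bessel_I_nonneg in \<open>fastforce intro: mult_nonneg_nonneg\<close>)
    then show ?thesis by (simp add: w_def zero_le_mult_iff)
  qed
  then show "0 \<le> x * (modified_bessel_I 0 x - modified_bessel_I 1 x)"
    using assms by (simp add: w_def)
  have I0: "modified_bessel_I 0 y \<le> exp y" if "0 \<le> y" for y
  proof -
    have "exp (- y) * modified_bessel_I 0 y \<le> exp (- 0) * modified_bessel_I 0 0"
    \<comment> \<open>The open interval matters: the sign of \<open>w z\<close> determines that of
      \<open>I\<^sub>0 - I\<^sub>1\<close> only for \<open>z > 0\<close>.\<close>
    proof (rule DERIV_nonpos_imp_decreasing_open[OF that])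
      fix z :: real assume z: "0 < z" "z < y"
      have "((\<lambda>y. exp (- y) * modified_bessel_I 0 y) has_real_derivative
          - exp (- z) * (modified_bessel_I 0 z - modified_bessel_I 1 z)) (at z)"
        by (rule derivative_eq_intros DERIV_modified_bessel_I0 refl)+ (simp add: algebra_simps)
      moreover have "0 \<le> modified_bessel_I 0 z - modified_bessel_I 1 z"
        using w0[of z] z unfolding w_def by (simp add: zero_le_mult_iff)
      ultimately show "\<exists>d. ((\<lambda>y. exp (- y) * modified_bessel_I 0 y) has_real_derivative d) (at z) \<and> d \<le> 0"
        by (intro exI conjI) (assumption, simp add: mult_nonneg_nonneg del: One_nat_def)
    qed (auto intro!: continuous_intros)
    then show ?thesis by (simp add: modified_bessel_I0_at_0 exp_minus field_simps)
  qed
  then show "modified_bessel_I 0 x \<le> exp x" using assms .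
  have "exp x * w x - exp (2 * x) / 2 \<le> exp 0 * w 0 - exp (2 * 0) / 2"
  proof (rule DERIV_nonpos_imp_nonincreasing[OF assms])
    fix z :: real assume z: "0 \<le> z" "z \<le> x"
    have "((\<lambda>x. exp x * w x - exp (2 * x) / 2) has_real_derivative
        exp z * modified_bessel_I 0 z - exp (2 * z)) (at z)"
      by (rule DERIV_diff[OF dw]) (auto intro!: derivative_eq_intros)
    moreover have "exp z * modified_bessel_I 0 z \<le> exp (2 * z)"
      using I0[OF z(1)] by (simp add: exp_double power2_eq_square)
    ultimately show "\<exists>d. ((\<lambda>x. exp x * w x - exp (2 * x) / 2) has_real_derivative d) (at z) \<and> d \<le> 0"
      by auto
  qed
  also have "\<dots> \<le> 0"
    by (simp add: w_def)
  finally have "exp x * w x \<le> exp x * (exp x / 2)"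
    using exp_double[of x] by (simp only: power2_eq_square)
  then show "x * (modified_bessel_I 0 x - modified_bessel_I 1 x) \<le> exp x / 2"
    unfolding w_def by (rule mult_left_le_imp_le) simp
qed

section \<open>Radial integration in the plane\<close>

text \<open>A substitute for polar coordinates. By scaling, the \<open>w\<close>-mass of the ball of
  radius \<open>r\<close> is \<open>C * r ^ (k + DIM('a))\<close>, and the density on the right is
  the derivative of this in \<open>r\<close>. Half-lines generate the Borel sets, so agreement on
  them suffices. The angular part of \<open>w\<close> enters only through \<open>C\<close>.\<close>

lemma distr_norm_homogeneous:
  fixes w :: "'a::euclidean_space \<Rightarrow> real"
  assumes [measurable]: "w \<in> borel_measurable borel"
    and hom: "\<And>c y. 0 < c \<Longrightarrow> w (c *\<^sub>R y) = c ^ k * w y"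
    and ball: "(\<integral>\<^sup>+y. ennreal (w y) * indicator (cball 0 1) y \<partial>lborel) = ennreal C"
    and C: "0 \<le> C"
  shows "distr (density lborel (\<lambda>y. ennreal (w y))) borel norm =
    density lborel (\<lambda>s. ennreal (C * (k + DIM('a)) * s ^ (k + DIM('a) - 1)) * indicator {0..} s)"
    (is "?M = ?N")
proof (rule measure_eqI_generator_eq[where E = "range atMost" and \<Omega> = UNIV and A = "\<lambda>i. {..real i}"])
  have [measurable]: "cball (0 :: 'a) r \<in> sets borel" for r
    by simp
  have M: "emeasure ?M {..r} = (\<integral>\<^sup>+y. ennreal (w y) * indicator (cball 0 r) y \<partial>lborel)" for r
  proof -
    have "emeasure ?M {..r} = emeasure (density lborel (\<lambda>y. ennreal (w y))) (norm -` {..r} \<inter> UNIV)"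
      by (subst emeasure_distr) auto
    also have "norm -` {..r} \<inter> UNIV = cball (0 :: 'a) r" by auto
    finally show ?thesis by (simp add: emeasure_density)
  qed
  have M_pos: "emeasure ?M {..r} = ennreal (C * r ^ (k + DIM('a)))" if r: "0 < r" for r
  proof -
    have "emeasure ?M {..r} = (\<integral>\<^sup>+y. ennreal (w y) * indicator (cball 0 r) y
        \<partial>density (distr lborel borel (\<lambda>x. 0 + r *\<^sub>R x)) (\<lambda>_. ennreal (\<bar>r\<bar> ^ DIM('a))))"
      unfolding M using r by (subst lborel_affine[of r 0]) auto
    also have "\<dots> = (\<integral>\<^sup>+x. ennreal (r ^ DIM('a)) * (ennreal (w (r *\<^sub>R x)) * indicator (cball 0 r) (r *\<^sub>R x)) \<partial>lborel)"
      using r by (subst nn_integral_density) (auto simp: nn_integral_distr)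
    also have "\<dots> = (\<integral>\<^sup>+x. ennreal (r ^ (k + DIM('a))) * (ennreal (w x) * indicator (cball 0 1) x) \<partial>lborel)"
      using r by (intro nn_integral_cong)
        (auto simp: hom power_add ennreal_mult' ennreal_mult'' mult_ac indicator_def)
    also have "\<dots> = ennreal (C * r ^ (k + DIM('a)))"
      using r C by (subst nn_integral_cmult) (auto simp: ball ennreal_mult mult_ac)
    finally show ?thesis .
  qed
  have N_pos: "emeasure ?N {..r} = ennreal (C * r ^ (k + DIM('a)))" if r: "0 \<le> r" for r
  proof -
    have "emeasure ?N {..r} = (\<integral>\<^sup>+s. ennreal (C * (k + DIM('a)) * s ^ (k + DIM('a) - 1)) * indicator {0..r} s \<partial>lborel)"
      by (subst emeasure_density) (auto intro!: nn_integral_cong simp: indicator_def)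
    also have "\<dots> = ennreal (C * r ^ (k + DIM('a)) - C * 0 ^ (k + DIM('a)))"
      using C r by (intro nn_integral_FTC_Icc) (auto intro!: derivative_eq_intros)
    finally show ?thesis by (simp add: power_0_left)
  qed
  show "emeasure ?M X = emeasure ?N X" if X: "X \<in> range atMost" for X
  proof -
    obtain r where r: "X = {..r}" using X by auto
    consider "r < 0" | "r = 0" | "0 < r" by linarith
    then show ?thesis
    proof cases
      case 1
      then have "cball (0 :: 'a) r = {}" by simp
      then have "emeasure ?M {..r} = 0" unfolding M by simp
      moreover have "emeasure ?N {..r} = 0"
        using 1 by (subst emeasure_density) (auto simp: indicator_def nn_integral_0_iff_AE)
      ultimately show ?thesis by (simp add: r)
    next
      \<comment> \<open>Scaling by \<open>r\<close> requires \<open>r > 0\<close>; at radius 0 the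
        ball is a single point and hence null.\<close>
      case 2
      have "AE y in lborel. y \<noteq> (0 :: 'a)" by (rule AE_lborel_singleton)
      then have "emeasure ?M {..r} = 0" unfolding M 2
        by (subst nn_integral_0_iff_AE) (auto elim!: eventually_mono simp: indicator_def)
      with N_pos[of 0] 2 show ?thesis by (simp add: r power_0_left)
    next
      case 3
      then show ?thesis by (simp only: r M_pos[OF 3] N_pos[OF less_imp_le])
    qed
  qed
  show "emeasure ?M {..real i} \<noteq> \<infinity>" for i
  proof -
    have "emeasure ?M {..real i} \<le> emeasure ?M {..real (Suc i)}"
      by (intro emeasure_mono) auto
    also have "\<dots> < \<infinity>" by (subst M_pos) auto
    finally show ?thesis by simp
  qed
  show "Int_stable (range (atMost :: real \<Rightarrow> real set))"
    by (auto simp: Int_stable_def)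
  show "sets ?M = sigma_sets UNIV (range atMost)" "sets ?N = sigma_sets UNIV (range atMost)"
    by (simp_all add: borel_eq_atMost) 
  show "(\<Union>i. {..real i}) = UNIV" by (auto intro: real_arch_simple)
qed auto

text \<open>Pairing \<open>exp x\<close> with \<open>exp (- x)\<close> leaves the even powers, whose
  terms are nonnegative, so that sums and integrals can later be interchanged in
  \<open>ennreal\<close>.\<close>

lemma cosh_sums:
  fixes x :: real
  shows "(\<lambda>m. 2 * x ^ (2 * m) / fact (2 * m)) sums (exp x + exp (- x))"
proof -
  have "(\<lambda>m. x ^ (2 * m) / fact (2 * m)) sums cosh x"
  proof -
    have "(\<lambda>n. if even n then x ^ n /\<^sub>R fact n else 0) sums cosh x"
      using cosh_converges[of x] .
    then show ?thesis
      by (subst (asm) sums_mono_reindex[symmetric, of "\<lambda>m. 2 * m"])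
        (auto simp: strict_mono_def field_simps elim!: evenE)
  qed
  moreover have "2 * cosh x = exp x + exp (- x)"
    by (simp add: cosh_field_def)
  ultimately show ?thesis
    using sums_mult[of "\<lambda>m. x ^ (2 * m) / fact (2 * m)" "cosh x" 2] by simp
qed

section \<open>Gaussian integrals and even moments of a linear form over the unit disc\<close>

lemma nn_integral_has_bochner_integral:
  assumes "has_bochner_integral M f x" and "\<And>y. 0 \<le> (f y :: real)"
  shows "(\<integral>\<^sup>+y. ennreal (f y) \<partial>M) = ennreal x"
  using assms by (simp add: has_bochner_integral_iff nn_integral_eq_integral)

text \<open>The constant weight 1 is homogeneous of degree 0 with unit-disc mass \<open>pi\<close>,
  which reduces the claim to the integral of \<open>s * exp (- s\<^sup>2)\<close> over the
  half-line.\<close>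

lemma nn_integral_gaussian_plane:
  "(\<integral>\<^sup>+y. ennreal (exp (- (norm y)\<^sup>2)) \<partial>(lborel :: (real^2) measure)) = ennreal pi"
proof -
  have "distr (density lborel (\<lambda>y::real^2. ennreal 1)) borel norm =
      density lborel (\<lambda>s. ennreal (pi * (0 + DIM(real^2)) * s ^ (0 + DIM(real^2) - 1)) * indicator {0..} s)"
    by (rule distr_norm_homogeneous) (auto simp: emeasure_cball unit_ball_vol_2)
  then have D: "distr lborel borel (norm :: real^2 \<Rightarrow> real) = density lborel (\<lambda>s. ennreal (2 * pi * s) * indicator {0..} s)"
    by (simp add: density_1 mult.commute)
  have "(\<integral>\<^sup>+y. ennreal (exp (- (norm y)\<^sup>2)) \<partial>(lborel :: (real^2) measure))
      = (\<integral>\<^sup>+s. ennreal (exp (- s\<^sup>2)) \<partial>distr lborel borel (norm :: real^2 \<Rightarrow> real))"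
    by (subst nn_integral_distr) auto
  also have "\<dots> = (\<integral>\<^sup>+s. ennreal (2 * pi) * ennreal (indicator {0..} s *\<^sub>R (exp (-s\<^sup>2) * s ^ (2 * 0 + 1))) \<partial>lborel)"
    unfolding D by (subst nn_integral_density)
      (auto intro!: nn_integral_cong simp: indicator_def ennreal_mult'[symmetric] mult_ac)
  also have "\<dots> = ennreal (2 * pi) * ennreal (fact 0 / 2)"
    by (subst nn_integral_cmult, measurable)
      (subst nn_integral_has_bochner_integral[OF gaussian_moment_odd_pos[of 0]], auto simp: indicator_def)
  also have "\<dots> = ennreal (2 * pi * (fact 0 / 2))"
    by (rule ennreal_mult'[symmetric]) simp
  finally show ?thesis by simp
qed

text \<open>A power series with a nonzero coefficient of positive index cannot vanish at points
  arbitrarily close to 0 on the right. The half-line is the natural domain here, as the variable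
  will be a square.\<close>

lemma powser_eq_0_imp_coeff_eq_0:
  fixes a :: "nat \<Rightarrow> real"
  assumes summ: "\<And>x. summable (\<lambda>n. a n * x ^ n)"
    and zero: "\<And>x. 0 \<le> x \<Longrightarrow> (\<Sum>n. a n * x ^ n) = 0"
  shows "a m = 0"
proof (cases "m = 0")
  case True
  have "(\<Sum>n. a n * 0 ^ n) = a 0" by simp
  with zero[of 0] True show ?thesis by simp
next
  case False
  show ?thesis
  proof (rule ccontr)
    assume nz: "a m \<noteq> 0"
    obtain s where "0 < s" and s: "\<And>z::real. z \<in> cball 0 s - {0} \<Longrightarrow> (\<Sum>n. a n * z ^ n) \<noteq> 0"
    proof (rule powser_0_nonzero[where r = 1 and \<xi> = 0 and a = a and m = m and f = "\<lambda>z. \<Sum>n. a n * z ^ n"])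
      show "(\<lambda>n. a n * (x - 0) ^ n) sums (\<Sum>n. a n * x ^ n)" for x
        using summ[of x] by (simp add: summable_sums)
      show "(\<Sum>n. a n * 0 ^ n) = 0" by (rule zero) simp
    qed (use nz False in auto)
    with s[of s] zero[of s] show False by auto
  qed
qed

text \<open>Completing the square and translating reduce this to the centred Gaussian.\<close>

lemma nn_integral_gaussian_exp:
  fixes x :: "real^2"
  shows "(\<integral>\<^sup>+y. ennreal (exp (- (norm y)\<^sup>2 + 2 * (x \<bullet> y))) \<partial>lborel) = ennreal (pi * exp ((norm x)\<^sup>2))"
proof -
  have "- (norm y)\<^sup>2 + 2 * (x \<bullet> y) = (norm x)\<^sup>2 + - (norm (- x + y))\<^sup>2" for y
    by (simp add: power2_norm_eq_inner inner_diff_left inner_diff_right inner_commute)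
  then have "(\<integral>\<^sup>+y. ennreal (exp (- (norm y)\<^sup>2 + 2 * (x \<bullet> y))) \<partial>lborel)
      = (\<integral>\<^sup>+y. ennreal (exp ((norm x)\<^sup>2)) * ennreal (exp (- (norm (- x + y))\<^sup>2)) \<partial>lborel)"
    by (simp only: exp_add ennreal_mult' exp_ge_zero)
  also have "\<dots> = ennreal (exp ((norm x)\<^sup>2)) * (\<integral>\<^sup>+y. ennreal (exp (- (norm (- x + y))\<^sup>2)) \<partial>lborel)"
    by (rule nn_integral_cmult) measurable
  also have "(\<integral>\<^sup>+y. ennreal (exp (- (norm (- x + y))\<^sup>2)) \<partial>lborel)
      = (\<integral>\<^sup>+y. ennreal (exp (- (norm y)\<^sup>2)) \<partial>distr lborel borel ((+) (- x)))"
    by (subst nn_integral_distr) auto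
  finally show ?thesis
    by (simp only: lborel_distr_plus nn_integral_gaussian_plane) (simp add: ennreal_mult' mult.commute)
qed

text \<open>The constant is found by expanding both sides of the Gaussian integral
  \<open>nn_integral_gaussian_exp\<close>, applied to \<open>l *\<^sub>R x\<close>, in powers of \<open>l\<^sup>2\<close>.\<close>

lemma nn_integral_cball_inner_power:
  fixes x :: "real^2"
  shows "(\<integral>\<^sup>+y. ennreal ((x \<bullet> y) ^ (2 * m)) * indicator (cball 0 1) y \<partial>lborel)
    = ennreal (pi * fact (2 * m) * norm x ^ (2 * m) / (4 ^ m * fact m * fact (m + 1)))"
proof -
  define J where "J m = (\<integral>\<^sup>+y. ennreal ((x \<bullet> y) ^ (2 * m)) * indicator (cball 0 1) y \<partial>lborel)" for m
  have even_nn: "0 \<le> (x \<bullet> y) ^ (2 * m)" for m y by (simp add: power_mult)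
  have J_fin: "J m < \<infinity>" for m
  proof -
    have "J m \<le> (\<integral>\<^sup>+y. ennreal (norm x ^ (2 * m)) * indicator (cball 0 1) (y :: real^2) \<partial>lborel)"
      unfolding J_def
    proof (rule nn_integral_mono)
      fix y :: "real^2"
      show "ennreal ((x \<bullet> y) ^ (2 * m)) * indicator (cball 0 1) y
        \<le> ennreal (norm x ^ (2 * m)) * indicator (cball 0 1) y"
      proof (cases "y \<in> cball 0 1")
        case True
        have "\<bar>x \<bullet> y\<bar> \<le> norm x * norm y" by (rule Cauchy_Schwarz_ineq2)
        also have "\<dots> \<le> norm x * 1" using True by (intro mult_left_mono) auto
        finally have "\<bar>x \<bullet> y\<bar> ^ (2 * m) \<le> norm x ^ (2 * m)" by (intro power_mono) auto
        then show ?thesis by (intro mult_right_mono ennreal_leI) (auto simp: power_even_abs)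
      qed simp
    qed
    also have "\<dots> < \<infinity>"
      by (subst nn_integral_cmult_indicator) (auto simp: ennreal_mult_less_top emeasure_cball)
    finally show ?thesis .
  qed
  define C where "C m = enn2real (J m)" for m
  have C0: "0 \<le> C m" and JC: "J m = ennreal (C m)" for m
    using J_fin[of m] by (simp_all add: C_def less_top)
  \<comment> \<open>The unit-disc moment \<open>C m\<close> is still unknown, but homogeneity
    expresses the Gaussian moment through it: the radial integral is \<open>fact m / 2\<close>,
    which with the factor \<open>2 * m + 2\<close> gives \<open>fact (m + 1)\<close>.\<close>
  have gauss: "(\<integral>\<^sup>+y. ennreal ((x \<bullet> y) ^ (2 * m)) * ennreal (exp (- (norm y)\<^sup>2)) \<partial>lborel)
      = ennreal (C m * fact (m + 1))" for m
  proof -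
    have D: "distr (density lborel (\<lambda>y. ennreal ((x \<bullet> y) ^ (2 * m)))) borel norm =
      density lborel (\<lambda>s. ennreal (C m * (2 * m + DIM(real^2)) * s ^ (2 * m + DIM(real^2) - 1)) * indicator {0..} s)"
      by (rule distr_norm_homogeneous) (auto simp: power_mult_distrib JC[symmetric] J_def C0)
    have "(\<integral>\<^sup>+y. ennreal ((x \<bullet> y) ^ (2 * m)) * ennreal (exp (- (norm y)\<^sup>2)) \<partial>lborel)
        = (\<integral>\<^sup>+s. ennreal (exp (- s\<^sup>2)) \<partial>distr (density lborel (\<lambda>y. ennreal ((x \<bullet> y) ^ (2 * m)))) borel norm)"
      by (subst nn_integral_distr) (auto simp: nn_integral_density)
    also have "\<dots> = (\<integral>\<^sup>+s. ennreal (C m * (2 * m + 2)) *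
        ennreal (indicator {0..} s *\<^sub>R (exp (-s\<^sup>2) * s ^ (2 * m + 1))) \<partial>lborel)"
      unfolding D by (subst nn_integral_density)
        (auto intro!: nn_integral_cong simp: indicator_def ennreal_mult'[symmetric] mult_ac C0)
    also have "\<dots> = ennreal (C m * (2 * m + 2)) * ennreal (fact m / 2)"
      by (subst nn_integral_cmult, measurable)
        (subst nn_integral_has_bochner_integral[OF gaussian_moment_odd_pos[of m]], auto simp: indicator_def)
    also have "\<dots> = ennreal (C m * (2 * m + 2) * (fact m / 2))"
      by (rule ennreal_mult'[symmetric]) (simp add: C0)
    also have "C m * (2 * m + 2) * (fact m / 2) = C m * fact (m + 1)"
      by (simp add: field_simps)
    finally show ?thesis .
  qed
  \<comment> \<open>\<open>b\<close> and \<open>d\<close> are the coefficients of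
    \<open>\<mu> ^ m\<close> on the two sides of the symmetrised Gaussian identity; equating them
    determines \<open>C m\<close>.\<close>
  define b where "b m = 2 * 4 ^ m * C m * fact (m + 1) / fact (2 * m)" for m
  define d where "d m = 2 * pi * ((norm x)\<^sup>2) ^ m / fact m" for m
  have b0: "0 \<le> b m" for m by (simp add: b_def C0)
  have b_sums: "(\<lambda>m. b m * \<mu> ^ m) sums (2 * pi * exp (\<mu> * (norm x)\<^sup>2))" if \<mu>: "0 \<le> \<mu>" for \<mu>
  proof -
    define l where "l = sqrt \<mu>"
    have l: "l\<^sup>2 = \<mu>" using \<mu> by (simp add: l_def)
    \<comment> \<open>The Gaussian integral has the same value at \<open>l *\<^sub>R x\<close> and
      \<open>(- l) *\<^sub>R x\<close>; adding the two copies produces the even series of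
      \<open>cosh_sums\<close>, in powers of \<open>l\<^sup>2 = \<mu>\<close>.\<close>
    have "ennreal (2 * pi * exp (\<mu> * (norm x)\<^sup>2)) = ennreal (pi * exp (\<mu> * (norm x)\<^sup>2)) + ennreal (pi * exp (\<mu> * (norm x)\<^sup>2))"
      by (subst ennreal_plus[symmetric]) auto
    also have "\<dots> = (\<integral>\<^sup>+y. ennreal (exp (- (norm y)\<^sup>2 + 2 * (l *\<^sub>R x \<bullet> y))) \<partial>lborel)
        + (\<integral>\<^sup>+y. ennreal (exp (- (norm y)\<^sup>2 + 2 * ((- l) *\<^sub>R x \<bullet> y))) \<partial>lborel)"
      unfolding nn_integral_gaussian_exp using \<mu> by (simp add: power_mult_distrib l)
    also have "\<dots> = (\<integral>\<^sup>+y. ennreal (exp (- (norm y)\<^sup>2 + 2 * (l *\<^sub>R x \<bullet> y))) + ennreal (exp (- (norm y)\<^sup>2 + 2 * ((- l) *\<^sub>R x \<bullet> y))) \<partial>lborel)"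
      by (rule nn_integral_add[symmetric]) auto
    also have "\<dots> = (\<integral>\<^sup>+y. (\<Sum>m. ennreal (2 * (2 * l) ^ (2 * m) / fact (2 * m)) *
        (ennreal ((x \<bullet> y) ^ (2 * m)) * ennreal (exp (- (norm y)\<^sup>2)))) \<partial>lborel)"
    proof (intro nn_integral_cong)
      fix y :: "real^2"
      let ?z = "2 * l * (x \<bullet> y)"
      have "(\<lambda>m. exp (- (norm y)\<^sup>2) * (2 * ?z ^ (2 * m) / fact (2 * m)))
          sums (exp (- (norm y)\<^sup>2) * (exp ?z + exp (- ?z)))"
        by (intro sums_mult cosh_sums)
      then have "(\<Sum>m. ennreal (exp (- (norm y)\<^sup>2) * (2 * ?z ^ (2 * m) / fact (2 * m))))
          = ennreal (exp (- (norm y)\<^sup>2) * (exp ?z + exp (- ?z)))"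
        by (intro suminf_ennreal_eq) (auto simp: power_mult)
      moreover have "ennreal (exp (- (norm y)\<^sup>2) * (2 * ?z ^ (2 * m) / fact (2 * m)))
          = ennreal (2 * (2 * l) ^ (2 * m) / fact (2 * m)) *
            (ennreal ((x \<bullet> y) ^ (2 * m)) * ennreal (exp (- (norm y)\<^sup>2)))" for m
        using even_nn[of y m]
        by (simp add: ennreal_mult'[symmetric] ennreal_mult''[symmetric] power_mult_distrib mult_ac)
      moreover have "ennreal (exp (- (norm y)\<^sup>2) * (exp ?z + exp (- ?z)))
          = ennreal (exp (- (norm y)\<^sup>2 + 2 * (l *\<^sub>R x \<bullet> y))) + ennreal (exp (- (norm y)\<^sup>2 + 2 * ((- l) *\<^sub>R x \<bullet> y)))"
        by (subst ennreal_plus[symmetric]) (auto simp: distrib_left mult_exp_exp mult_ac)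
      ultimately show "ennreal (exp (- (norm y)\<^sup>2 + 2 * (l *\<^sub>R x \<bullet> y))) + ennreal (exp (- (norm y)\<^sup>2 + 2 * ((- l) *\<^sub>R x \<bullet> y)))
          = (\<Sum>m. ennreal (2 * (2 * l) ^ (2 * m) / fact (2 * m)) *
            (ennreal ((x \<bullet> y) ^ (2 * m)) * ennreal (exp (- (norm y)\<^sup>2))))"
        by (simp only:)
    qed
    also have "\<dots> = (\<Sum>m. ennreal (2 * (2 * l) ^ (2 * m) / fact (2 * m)) * ennreal (C m * fact (m + 1)))"
      by (subst nn_integral_suminf) (auto simp: nn_integral_cmult gauss)
    also have "\<dots> = (\<Sum>m. ennreal (b m * \<mu> ^ m))"
    proof (intro suminf_cong)
      fix m
      have "(2 * l) ^ (2 * m) = 4 ^ m * \<mu> ^ m"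
        by (simp add: power_mult power_mult_distrib l)
      then have "2 * (2 * l) ^ (2 * m) / fact (2 * m) * (C m * fact (m + 1)) = b m * \<mu> ^ m"
        by (simp add: b_def mult_ac del: fact_Suc)
      then show "ennreal (2 * (2 * l) ^ (2 * m) / fact (2 * m)) * ennreal (C m * fact (m + 1)) = ennreal (b m * \<mu> ^ m)"
        by (subst ennreal_mult'[symmetric]) (auto simp: power_mult)
    qed
    finally have eq: "(\<Sum>m. ennreal (b m * \<mu> ^ m)) = ennreal (2 * pi * exp (\<mu> * (norm x)\<^sup>2))" by simp
    then have summ: "summable (\<lambda>m. b m * \<mu> ^ m)"
      using \<mu> b0 by (intro summable_suminf_not_top) auto
    with eq have "ennreal (\<Sum>m. b m * \<mu> ^ m) = ennreal (2 * pi * exp (\<mu> * (norm x)\<^sup>2))"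
      using \<mu> b0 by (subst (asm) suminf_ennreal2) auto
    then have "(\<Sum>m. b m * \<mu> ^ m) = 2 * pi * exp (\<mu> * (norm x)\<^sup>2)"
      using \<mu> b0 by (subst (asm) ennreal_inj) (auto intro!: suminf_nonneg summ)
    with summable_sums[OF summ] show ?thesis by simp
  qed
  have d_sums: "(\<lambda>m. d m * \<mu> ^ m) sums (2 * pi * exp (\<mu> * (norm x)\<^sup>2))" for \<mu>
    using sums_mult[OF exp_converges[of "\<mu> * (norm x)\<^sup>2"], of "2 * pi"]
    by (simp add: d_def power_mult_distrib field_simps)
  have "b m - d m = 0" for m
  proof (rule powser_eq_0_imp_coeff_eq_0[of "\<lambda>m. b m - d m"])
    fix \<mu> :: real
    \<comment> \<open>Negative \<open>\<mu>\<close> is covered by absolute convergence at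
      \<open>\<bar>\<mu>\<bar>\<close>, since the coefficients are nonnegative.\<close>
    have "summable (\<lambda>m. b m * \<mu> ^ m)"
    proof (rule summable_norm_cancel)
      show "summable (\<lambda>m. norm (b m * \<mu> ^ m))"
        using sums_summable[OF b_sums[of "\<bar>\<mu>\<bar>"]] by (simp add: abs_mult power_abs b0)
    qed
    from summable_diff[OF this sums_summable[OF d_sums[of \<mu>]]]
    show "summable (\<lambda>m. (b m - d m) * \<mu> ^ m)" by (simp add: left_diff_distrib)
  next
    fix \<mu> :: real assume "0 \<le> \<mu>"
    from sums_diff[OF b_sums[OF this] d_sums[of \<mu>]]
    show "(\<Sum>m. (b m - d m) * \<mu> ^ m) = 0"
      by (simp add: left_diff_distrib sums_iff)
  qed
  then have "2 * 4 ^ m * C m * fact (m + 1) / fact (2 * m) = 2 * pi * ((norm x)\<^sup>2) ^ m / fact m"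
    by (simp add: b_def d_def del: fact_Suc)
  then have "C m = pi * fact (2 * m) * norm x ^ (2 * m) / (4 ^ m * fact m * fact (m + 1))"
    by (simp add: power_mult divide_simps del: fact_Suc) (simp add: mult_ac del: fact_Suc)?
  then show ?thesis using JC[of m] by (simp add: J_def)
qed

section \<open>Polar coordinates with an exponential weight\<close>

lemma nn_integral_lborel_reflect:
  fixes f :: "'a::euclidean_space \<Rightarrow> ennreal"
  assumes [measurable]: "f \<in> borel_measurable borel"
  shows "(\<integral>\<^sup>+y. f (- y) \<partial>lborel) = (\<integral>\<^sup>+y. f y \<partial>lborel)"
proof -
  have "lborel = distr lborel borel (uminus :: 'a \<Rightarrow> 'a)"
    using lborel_affine[of "-1" "0 :: 'a"] by (simp add: density_1)
  then have "(\<integral>\<^sup>+y. f y \<partial>lborel) = (\<integral>\<^sup>+y. f y \<partial>distr lborel borel uminus)"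
    by simp
  also have "\<dots> = (\<integral>\<^sup>+y. f (- y) \<partial>lborel)"
    by (subst nn_integral_distr) auto
  finally show ?thesis ..
qed

text \<open>The mean of \<open>exp (x \<bullet> y)\<close> over the circle of radius
  \<open>s\<close> is \<open>I\<^sub>0 (norm x * s)\<close>. This is obtained without angular
  integrals: each even power of \<open>x \<bullet> y\<close> is a homogeneous weight with known
  constant, and the resulting radial densities sum to the Bessel series.\<close>

lemma distr_norm_exp_inner:
  fixes x :: "real^2"
  shows "distr (density lborel (\<lambda>y. ennreal (exp (x \<bullet> y)))) borel norm
    = density lborel (\<lambda>s. ennreal (2 * pi * s * modified_bessel_I 0 (norm x * s)) * indicator {0..} s)"
    (is "?M = ?N")
proof (rule measure_eqI)
  fix A assume "A \<in> sets ?M"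
  then have A [measurable]: "A \<in> sets borel" by simp
  define C where "C m = pi * fact (2 * m) * norm x ^ (2 * m) / (4 ^ m * fact m * fact (m + 1))" for m
  have C0: "0 \<le> C m" for m by (simp add: C_def)
  have even_nn: "0 \<le> (x \<bullet> y) ^ (2 * m)" for m y by (simp add: power_mult)
  define E where "E x = (\<integral>\<^sup>+y. ennreal (exp (x \<bullet> y)) * indicator A (norm y) \<partial>lborel)" for x :: "real^2"
  have M: "emeasure ?M A = E x"
  proof -
    have "emeasure ?M A = (\<integral>\<^sup>+s. indicator A s \<partial>?M)" by simp
    also have "\<dots> = E x"
      unfolding E_def by (subst nn_integral_distr) (auto simp: nn_integral_density)
    finally show ?thesis .
  qed
  have moment: "(\<integral>\<^sup>+y. ennreal ((x \<bullet> y) ^ (2 * m)) * indicator A (norm y) \<partial>lborel)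
    = (\<integral>\<^sup>+s. ennreal (C m * (2 * m + 2) * s ^ (2 * m + 1)) * indicator {0..} s * indicator A s \<partial>lborel)" for m
  proof -
    have D: "distr (density lborel (\<lambda>y. ennreal ((x \<bullet> y) ^ (2 * m)))) borel norm =
      density lborel (\<lambda>s. ennreal (C m * (2 * m + DIM(real^2)) * s ^ (2 * m + DIM(real^2) - 1)) * indicator {0..} s)"
      by (rule distr_norm_homogeneous)
        (use nn_integral_cball_inner_power[of x m] in \<open>auto simp: power_mult_distrib C0 C_def\<close>)
    have "(\<integral>\<^sup>+y. ennreal ((x \<bullet> y) ^ (2 * m)) * indicator A (norm y) \<partial>lborel)
        = (\<integral>\<^sup>+s. indicator A s \<partial>distr (density lborel (\<lambda>y. ennreal ((x \<bullet> y) ^ (2 * m)))) borel norm)"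
      by (subst nn_integral_distr) (auto simp: nn_integral_density)
    also have "\<dots> = (\<integral>\<^sup>+s. ennreal (C m * (2 * m + 2) * s ^ (2 * m + 1)) * indicator {0..} s * indicator A s \<partial>lborel)"
      unfolding D by (subst nn_integral_density) auto
    finally show ?thesis .
  qed
  \<comment> \<open>Reflection makes \<open>E\<close> even; doubling replaces the exponential by its
    even series, and the factor 2 is cancelled at the end.\<close>
  have "E x + E x = E x + E (- x)"
    unfolding E_def
    by (subst (4) nn_integral_lborel_reflect[symmetric]) auto
  also have "\<dots> = (\<integral>\<^sup>+y. ennreal (exp (x \<bullet> y)) * indicator A (norm y) + ennreal (exp (- x \<bullet> y)) * indicator A (norm y) \<partial>lborel)"
    unfolding E_def by (rule nn_integral_add[symmetric]) auto
  also have "\<dots> = (\<integral>\<^sup>+y. (\<Sum>m. ennreal (2 / fact (2 * m)) * (ennreal ((x \<bullet> y) ^ (2 * m)) * indicator A (norm y))) \<partial>lborel)"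
  proof (intro nn_integral_cong)
    fix y :: "real^2"
    have "(\<Sum>m. ennreal (2 * (x \<bullet> y) ^ (2 * m) / fact (2 * m))) = ennreal (exp (x \<bullet> y) + exp (- (x \<bullet> y)))"
      by (intro suminf_ennreal_eq cosh_sums) (auto simp: power_mult)
    moreover have "ennreal (2 * (x \<bullet> y) ^ (2 * m) / fact (2 * m)) = ennreal (2 / fact (2 * m)) * ennreal ((x \<bullet> y) ^ (2 * m))" for m
      by (subst ennreal_mult[symmetric]) (auto simp: power_mult)
    ultimately have "(\<Sum>m. ennreal (2 / fact (2 * m)) * ennreal ((x \<bullet> y) ^ (2 * m)))
        = ennreal (exp (x \<bullet> y)) + ennreal (exp (- x \<bullet> y))"
      by (simp add: ennreal_plus)
    then show "ennreal (exp (x \<bullet> y)) * indicator A (norm y) + ennreal (exp (- x \<bullet> y)) * indicator A (norm y)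
        = (\<Sum>m. ennreal (2 / fact (2 * m)) * (ennreal ((x \<bullet> y) ^ (2 * m)) * indicator A (norm y)))"
      by (cases "norm y \<in> A") auto
  qed
  also have "\<dots> = (\<Sum>m. ennreal (2 / fact (2 * m)) *
      (\<integral>\<^sup>+s. ennreal (C m * (2 * m + 2) * s ^ (2 * m + 1)) * indicator {0..} s * indicator A s \<partial>lborel))"
    by (subst nn_integral_suminf) (auto simp: nn_integral_cmult moment)
  also have "\<dots> = (\<integral>\<^sup>+s. (\<Sum>m. ennreal (2 / fact (2 * m)) *
      (ennreal (C m * (2 * m + 2) * s ^ (2 * m + 1)) * indicator {0..} s * indicator A s)) \<partial>lborel)"
    by (subst nn_integral_suminf) (auto simp: nn_integral_cmult)
  also have "\<dots> = (\<integral>\<^sup>+s. 2 * (ennreal (2 * pi * s * modified_bessel_I 0 (norm x * s)) * indicator {0..} s * indicator A s) \<partial>lborel)"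
  proof (intro nn_integral_cong)
    fix s :: real
    have "(\<Sum>m. ennreal (2 / fact (2 * m)) * ennreal (C m * (2 * m + 2) * s ^ (2 * m + 1)))
        = 2 * ennreal (2 * pi * s * modified_bessel_I 0 (norm x * s))" if s: "0 \<le> s"
    proof -
      have "(\<lambda>m. 4 * pi * s * ((norm x * s / 2) ^ (2 * m + 0) / (fact m * fact (m + 0))))
          sums (4 * pi * s * modified_bessel_I 0 (norm x * s))"
        unfolding modified_bessel_I_def by (intro sums_mult summable_sums modified_bessel_I_summable)
      then have "(\<Sum>m. ennreal (4 * pi * s * ((norm x * s / 2) ^ (2 * m + 0) / (fact m * fact (m + 0)))))
          = ennreal (4 * pi * s * modified_bessel_I 0 (norm x * s))"
        using s by (intro suminf_ennreal_eq) auto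
      \<comment> \<open>\<open>fact (2 * m)\<close> cancels and \<open>2 * m + 2\<close> absorbs the
        last factor of \<open>fact (m + 1)\<close>, leaving the squared factorial of the
        \<open>I\<^sub>0\<close> series.\<close>
      moreover have "2 / fact (2 * m) * (C m * (2 * m + 2) * s ^ (2 * m + 1))
          = 4 * pi * s * ((norm x * s / 2) ^ (2 * m + 0) / (fact m * fact (m + 0)))" for m
      proof -
        have "C m * (2 * m + 2) = 2 * pi * fact (2 * m) * norm x ^ (2 * m) / (4 ^ m * fact m * fact m)"
          by (simp add: C_def divide_simps)
        moreover have "(norm x * s / 2) ^ (2 * m) = norm x ^ (2 * m) * s ^ (2 * m) / 4 ^ m"
          by (simp add: power_mult_distrib power_divide power_mult)
        ultimately show ?thesis by (simp add: mult_ac)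
      qed
      moreover have "ennreal (2 / fact (2 * m)) * ennreal (C m * (2 * m + 2) * s ^ (2 * m + 1))
          = ennreal (2 / fact (2 * m) * (C m * (2 * m + 2) * s ^ (2 * m + 1)))" for m
        by (rule ennreal_mult'[symmetric]) simp
      moreover have "ennreal (4 * pi * s * modified_bessel_I 0 (norm x * s))
          = 2 * ennreal (2 * pi * s * modified_bessel_I 0 (norm x * s))"
        using ennreal_mult'[of 2 "2 * pi * s * modified_bessel_I 0 (norm x * s)"] by (simp add: mult_ac)
      ultimately show ?thesis by (simp only:)
    qed
    then show "(\<Sum>m. ennreal (2 / fact (2 * m)) *
        (ennreal (C m * (2 * m + 2) * s ^ (2 * m + 1)) * indicator {0..} s * indicator A s))
      = 2 * (ennreal (2 * pi * s * modified_bessel_I 0 (norm x * s)) * indicator {0..} s * indicator A s)"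
      by (auto simp: indicator_def)
  qed
  also have "\<dots> = 2 * emeasure ?N A"
    by (subst nn_integral_cmult) (auto simp: emeasure_density)
  finally have "2 * E x = 2 * emeasure ?N A" by (simp only: mult_2)
  then show "emeasure ?M A = emeasure ?N A"
    unfolding M by (simp add: ennreal_mult_cancel_left)
qed simp

text \<open>Both sides are the integral of \<open>f\<close> against the pushed-forward measure. The
  transport and density rules for the Bochner integral also cover non-integrable \<open>f\<close>,
  where both sides are 0.\<close>

lemma integral_norm_exp_inner:
  fixes x :: "real^2" and f :: "real \<Rightarrow> real"
  assumes [measurable]: "f \<in> borel_measurable borel"
  shows "(\<integral>y. exp (x \<bullet> y) * f (norm y) \<partial>lborel)
    = (LINT s:{0..}|lborel. 2 * pi * s * modified_bessel_I 0 (norm x * s) * f s)"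
proof -
  have "(\<integral>y. exp (x \<bullet> y) * f (norm y) \<partial>lborel) = (\<integral>y. f (norm y) \<partial>density lborel (\<lambda>y. ennreal (exp (x \<bullet> y))))"
    by (subst integral_density) auto
  also have "\<dots> = (\<integral>s. f s \<partial>distr (density lborel (\<lambda>y. ennreal (exp (x \<bullet> y)))) borel norm)"
    by (subst integral_distr) auto
  \<comment> \<open>With the indicator inside, the real density is nonnegative on the whole line, as
    the density rule requires.\<close>
  also have "\<dots> = (\<integral>s. f s \<partial>density lborel (\<lambda>s. ennreal (indicator {0..} s * (2 * pi * s * modified_bessel_I 0 (norm x * s)))))"
    unfolding distr_norm_exp_inner
    by (intro arg_cong2[where f = "lebesgue_integral"] density_cong refl) (auto simp: indicator_def)
  also have "\<dots> = (\<integral>s. indicator {0..} s * (2 * pi * s * modified_bessel_I 0 (norm x * s)) * f s \<partial>lborel)"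
    by (subst integral_density) (auto simp: indicator_def modified_bessel_I_nonneg)
  finally show ?thesis by (simp add: set_lebesgue_integral_def mult_ac)
qed

text \<open>Ordinary polar coordinates are the case \<open>x = 0\<close>, where the exponential and
  \<open>I\<^sub>0 0\<close> both equal 1; the ball is encoded by cutting off the radial
  function.\<close>

lemma LINT_cball_radial:
  fixes f :: "real \<Rightarrow> real"
  assumes [measurable]: "f \<in> borel_measurable borel"
  shows "(LINT x:cball (0 :: real^2) R|lborel. f (norm x)) = (LINT q:{0..R}|lborel. 2 * pi * q * f q)"
proof -
  have "(LINT x:cball (0 :: real^2) R|lborel. f (norm x))
      = (\<integral>y. exp ((0 :: real^2) \<bullet> y) * (indicator {..R} (norm y) * f (norm y)) \<partial>lborel)"
    unfolding set_lebesgue_integral_def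
    by (intro Bochner_Integration.integral_cong) (auto simp: indicator_def)
  also have "\<dots> = (LINT s:{0..}|lborel. 2 * pi * s * modified_bessel_I 0 (norm (0 :: real^2) * s) * (indicator {..R} s * f s))"
    by (rule integral_norm_exp_inner) measurable
  also have "\<dots> = (LINT q:{0..R}|lborel. 2 * pi * q * f q)"
    unfolding set_lebesgue_integral_def
    by (intro Bochner_Integration.integral_cong) (auto simp: indicator_def modified_bessel_I0_at_0)
  finally show ?thesis .
qed

section \<open>Heat flow of discs\<close>

text \<open>For \<open>\<rho> = 1 / (4 t D)\<close> this is the \<open>\<rho>\<close>-derivative of
  the heat solution of the disc of radius \<open>a\<close> at distance \<open>q\<close> from its
  centre. The integrand of the sensitivity kernel is a product of two such fluxes.\<close>

definition disc_flux :: "real \<Rightarrow> real \<Rightarrow> real \<Rightarrow> real" where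
  "disc_flux a q \<rho> = a * exp (- \<rho> * (q\<^sup>2 + a\<^sup>2)) *
     (a * modified_bessel_I 0 (2 * q * a * \<rho>) - q * modified_bessel_I 1 (2 * q * a * \<rho>))"

text \<open>The planar heat kernel integrated over the circle of radius \<open>s\<close>, seen from
  distance \<open>q\<close>. For \<open>\<rho> > 0\<close> it is the density in \<open>s\<close> of
  a Rice distribution.\<close>

definition radial_heat_density :: "real \<Rightarrow> real \<Rightarrow> real \<Rightarrow> real" where
  "radial_heat_density q \<rho> s = 2 * \<rho> * s * exp (- \<rho> * (q\<^sup>2 + s\<^sup>2)) * modified_bessel_I 0 (2 * q * s * \<rho>)"

lemma continuous_on_disc_flux [continuous_intros]:
  "continuous_on S f \<Longrightarrow> continuous_on S g \<Longrightarrow> continuous_on S h \<Longrightarrow>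
    continuous_on S (\<lambda>x. disc_flux (f x) (g x) (h x))"
  unfolding disc_flux_def by (intro continuous_intros)

lemma continuous_on_radial_heat_density [continuous_intros]:
  "continuous_on S f \<Longrightarrow> continuous_on S g \<Longrightarrow> continuous_on S h \<Longrightarrow>
    continuous_on S (\<lambda>x. radial_heat_density (f x) (g x) (h x))"
  unfolding radial_heat_density_def by (intro continuous_intros)

definition radial_heat_density_deriv :: "real \<Rightarrow> real \<Rightarrow> real \<Rightarrow> real" where
  "radial_heat_density_deriv q \<rho> s = 2 * s * exp (- \<rho> * (q\<^sup>2 + s\<^sup>2)) *
     ((1 - \<rho> * (q\<^sup>2 + s\<^sup>2)) * modified_bessel_I 0 (2 * q * s * \<rho>)
      + 2 * q * s * \<rho> * modified_bessel_I 1 (2 * q * s * \<rho>))"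

lemma DERIV_radial_heat_density:
  "((\<lambda>\<rho>. radial_heat_density q \<rho> s) has_real_derivative radial_heat_density_deriv q \<rho> s) (at \<rho> within S)"
proof -
  have "((\<lambda>\<rho>. modified_bessel_I 0 (2 * q * s * \<rho>)) has_real_derivative
      modified_bessel_I 1 (2 * q * s * \<rho>) * (2 * q * s)) (at \<rho> within S)"
    by (rule DERIV_chain2[OF DERIV_modified_bessel_I0]) (auto intro!: derivative_eq_intros)
  then show ?thesis
    unfolding radial_heat_density_def radial_heat_density_deriv_def
    by (auto intro!: derivative_eq_intros simp: algebra_simps simp del: One_nat_def)
qed

text \<open>The heat equation in divergence form.\<close>

lemma DERIV_disc_flux_radius:
  assumes "\<rho> \<noteq> 0"
  shows "((\<lambda>s. disc_flux s q \<rho>) has_real_derivative radial_heat_density_deriv q \<rho> s) (at s within S)"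
proof -
  define A where "A s = modified_bessel_I 0 (2 * q * s * \<rho>)" for s
  define B where "B s = (2 * q * s * \<rho>) * modified_bessel_I 1 (2 * q * s * \<rho>)" for s
  \<comment> \<open>The flux is written through \<open>I\<^sub>0\<close> and
    \<open>x I\<^sub>1\<close> so that the two Bessel derivative rules apply directly; the division
    by \<open>2 * \<rho>\<close> uses \<open>\<rho> \<noteq> 0\<close>.\<close>
  have eq: "disc_flux s q \<rho> = exp (- \<rho> * (q\<^sup>2 + s\<^sup>2)) * (s\<^sup>2 * A s - B s / (2 * \<rho>))" for s
    using assms by (simp add: disc_flux_def A_def B_def power2_eq_square algebra_simps)
  have A: "(A has_real_derivative modified_bessel_I 1 (2 * q * s * \<rho>) * (2 * q * \<rho>)) (at s within S)"
    unfolding A_def by (rule DERIV_chain2[OF DERIV_modified_bessel_I0]) (auto intro!: derivative_eq_intros)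
  have B: "(B has_real_derivative (2 * q * s * \<rho>) * A s * (2 * q * \<rho>)) (at s within S)"
    unfolding A_def B_def
    by (rule DERIV_chain2[OF DERIV_mult_modified_bessel_I1]) (auto intro!: derivative_eq_intros)
  have "((\<lambda>s. exp (- \<rho> * (q\<^sup>2 + s\<^sup>2)) * (s\<^sup>2 * A s - B s / (2 * \<rho>))) has_real_derivative
      exp (- \<rho> * (q\<^sup>2 + s\<^sup>2)) * (- \<rho> * (2 * s)) * (s\<^sup>2 * A s - B s / (2 * \<rho>)) +
      (2 * s * A s + s\<^sup>2 * (modified_bessel_I 1 (2 * q * s * \<rho>) * (2 * q * \<rho>))
        - (2 * q * s * \<rho>) * A s * (2 * q * \<rho>) / (2 * \<rho>)) * exp (- \<rho> * (q\<^sup>2 + s\<^sup>2))) (at s within S)"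
    by (auto intro!: derivative_eq_intros A B)
  also have "exp (- \<rho> * (q\<^sup>2 + s\<^sup>2)) * (- \<rho> * (2 * s)) * (s\<^sup>2 * A s - B s / (2 * \<rho>)) +
      (2 * s * A s + s\<^sup>2 * (modified_bessel_I 1 (2 * q * s * \<rho>) * (2 * q * \<rho>))
        - (2 * q * s * \<rho>) * A s * (2 * q * \<rho>) / (2 * \<rho>)) * exp (- \<rho> * (q\<^sup>2 + s\<^sup>2))
      = radial_heat_density_deriv q \<rho> s"
    using assms unfolding radial_heat_density_deriv_def B_def A_def[symmetric]
    by (simp add: algebra_simps power2_eq_square del: One_nat_def)
  finally show ?thesis unfolding eq .
qed

text \<open>Differentiation under the integral, followed by the fundamental theorem in
  \<open>s\<close>: the derivative of the density is an exact \<open>s\<close>-derivative, and the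
  flux vanishes at \<open>s = 0\<close>.\<close>

lemma DERIV_integral_radial_heat_density:
  assumes "0 < \<rho>" and "0 \<le> a"
  shows "((\<lambda>\<rho>. integral {0..a} (radial_heat_density q \<rho>)) has_real_derivative disc_flux a q \<rho>) (at \<rho>)"
proof -
  have "((\<lambda>\<rho>. integral (cbox 0 a) (radial_heat_density q \<rho>)) has_real_derivative
      integral (cbox 0 a) (radial_heat_density_deriv q \<rho>)) (at \<rho> within {0<..})"
  proof (rule leibniz_rule_field_derivative)
    show "radial_heat_density q \<rho> integrable_on cbox 0 a" for \<rho>
      by (intro integrable_continuous continuous_intros)
    show "continuous_on ({0<..} \<times> cbox 0 a) (\<lambda>(\<rho>, s). radial_heat_density_deriv q \<rho> s)"
      unfolding radial_heat_density_deriv_def split_beta by (intro continuous_intros)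
  qed (use assms in \<open>auto intro: DERIV_radial_heat_density\<close>)
  moreover have "(radial_heat_density_deriv q \<rho> has_integral disc_flux a q \<rho> - disc_flux 0 q \<rho>) {0..a}"
    using assms by (intro fundamental_theorem_of_calculus)
      (auto simp flip: has_real_derivative_iff_has_vector_derivative intro!: DERIV_disc_flux_radius)
  then have "integral {0..a} (radial_heat_density_deriv q \<rho>) = disc_flux a q \<rho>"
    by (simp add: integral_unique disc_flux_def)
  moreover have "at \<rho> within {0<..} = at \<rho>"
    using assms by (intro at_within_open) auto
  ultimately show ?thesis by (simp add: cbox_interval)
qed

text \<open>Expanding the square of \<open>norm (x - y)\<close> splits the kernel into a factor in
  \<open>x\<close>, a radial factor in \<open>y\<close>, and
  \<open>exp ((2 * \<rho>) *\<^sub>R x \<bullet> y)\<close>, to which the weighted polar coordinates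
  apply.\<close>

lemma heat_solution_radial:
  fixes x :: "real^2" and h :: "real \<Rightarrow> real"
  assumes "0 < t" and "0 < D" and [measurable]: "h \<in> borel_measurable borel"
    and u0: "\<And>y. u0 y = h (norm y)"
  shows "heat_solution u0 D x t =
    (LINT s:{0..}|lborel. radial_heat_density (norm x) (1 / (4 * (t * D))) s * h s)"
proof -
  define \<rho> where "\<rho> = 1 / (4 * (t * D))"
  have \<rho>: "0 < \<rho>" using assms by (simp add: \<rho>_def)
  have "heat_kernel (x - y) (t * D) * u0 y
      = \<rho> / pi * exp (- \<rho> * (norm x)\<^sup>2) * (exp ((2 * \<rho>) *\<^sub>R x \<bullet> y) * (exp (- \<rho> * (norm y)\<^sup>2) * h (norm y)))" for y
  proof -
    have nd: "(norm (x - y))\<^sup>2 = (norm x)\<^sup>2 + (norm y)\<^sup>2 - 2 * (x \<bullet> y)"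
      by (simp add: power2_norm_eq_inner inner_diff_left inner_diff_right inner_commute)
    have "- \<rho> * (norm (x - y))\<^sup>2
        = - \<rho> * (norm x)\<^sup>2 + ((2 * \<rho>) *\<^sub>R x \<bullet> y) + - \<rho> * (norm y)\<^sup>2"
      unfolding nd inner_scaleR_left by (simp add: algebra_simps)
    moreover have "- (norm (x - y))\<^sup>2 / (4 * (t * D)) = - \<rho> * (norm (x - y))\<^sup>2"
      by (simp add: \<rho>_def)
    ultimately have "exp (- (norm (x - y))\<^sup>2 / (4 * (t * D)))
        = exp (- \<rho> * (norm x)\<^sup>2) * exp ((2 * \<rho>) *\<^sub>R x \<bullet> y) * exp (- \<rho> * (norm y)\<^sup>2)"
      by (simp only: exp_add)
    moreover have "1 / (4 * pi * (t * D)) = \<rho> / pi" by (simp add: \<rho>_def)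
    ultimately show ?thesis
      by (simp only: heat_kernel_def u0 mult.assoc)
  qed
  then have "heat_solution u0 D x t = \<rho> / pi * exp (- \<rho> * (norm x)\<^sup>2) *
      (\<integral>y. exp ((2 * \<rho>) *\<^sub>R x \<bullet> y) * (exp (- \<rho> * (norm y)\<^sup>2) * h (norm y)) \<partial>lborel)"
    using assms by (simp add: heat_solution_def)
  also have "\<dots> = \<rho> / pi * exp (- \<rho> * (norm x)\<^sup>2) *
      (LINT s:{0..}|lborel. 2 * pi * s * modified_bessel_I 0 (norm ((2 * \<rho>) *\<^sub>R x) * s) * (exp (- \<rho> * s\<^sup>2) * h s))"
    by (subst integral_norm_exp_inner[where f = "\<lambda>s. exp (- \<rho> * s\<^sup>2) * h s"]) auto
  also have "\<dots> = (LINT s:{0..}|lborel. \<rho> / pi * exp (- \<rho> * (norm x)\<^sup>2) *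
      (2 * pi * s * modified_bessel_I 0 (norm ((2 * \<rho>) *\<^sub>R x) * s) * (exp (- \<rho> * s\<^sup>2) * h s)))"
    by (rule set_integral_mult_right[symmetric])
  also have "\<dots> = (LINT s:{0..}|lborel. radial_heat_density (norm x) \<rho> s * h s)"
    using \<rho> by (intro set_lebesgue_integral_cong)
      (auto simp: radial_heat_density_def distrib_left exp_diff exp_minus field_simps)
  finally show ?thesis by (simp add: \<rho>_def)
qed

lemma heat_solution_discs:
  fixes x :: "real^2" and h :: "real \<Rightarrow> real"
  assumes "0 < t" and "0 < D" and "finite J" and "finite F"
    and u0: "\<And>y. u0 y = h (norm y)"
    and h: "\<And>s. 0 \<le> s \<Longrightarrow> s \<notin> F \<Longrightarrow> h s = (\<Sum>j\<in>J. c j * indicator {..<a j} s)"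
  shows "heat_solution u0 D x t =
    (\<Sum>j\<in>J. c j * integral {0..a j} (radial_heat_density (norm x) (1 / (4 * (t * D)))))"
proof -
  define p where "p = radial_heat_density (norm x) (1 / (4 * (t * D)))"
  have cont: "continuous_on S p" for S
    unfolding p_def by (intro continuous_intros)
  have p [measurable]: "p \<in> borel_measurable borel"
    using cont by (rule borel_measurable_continuous_onI)
  \<comment> \<open>Nothing is known about \<open>h\<close> on negative arguments, not even
    measurability. Replacing its values there does not affect \<open>h (norm y)\<close>.\<close>
  define h' where "h' s = (if 0 \<le> s then h s else \<Sum>j\<in>J. c j * indicator {..<a j} s)" for s
  have h' [measurable]: "h' \<in> borel_measurable borel"
  proof (rule measurable_discrete_difference[where X = F])
    show "(\<lambda>s. \<Sum>j\<in>J. c j * indicator {..<a j} s) \<in> borel_measurable borel" by measurable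
  qed (use \<open>finite F\<close> h in \<open>auto simp: h'_def intro: countable_finite\<close>)
  have int: "set_integrable lborel {0..a j} p" for j
    by (intro borel_integrable_atLeastAtMost' cont)
  have "heat_solution u0 D x t = (LINT s:{0..}|lborel. p s * h' s)"
    unfolding p_def by (rule heat_solution_radial[OF assms(1,2) h']) (simp add: h'_def u0)
  also have "\<dots> = (\<integral>s. (\<Sum>j\<in>J. c j * (indicator {0..a j} s *\<^sub>R p s)) \<partial>lborel)"
    unfolding set_lebesgue_integral_def
  proof (rule integral_cong_AE)
    \<comment> \<open>Besides the exceptional set \<open>F\<close>, the radii are removed because
      \<open>{..<a j}\<close> and \<open>{0..a j}\<close> differ there.\<close>
    have "AE s in lborel. s \<notin> F \<union> a ` J"
      using \<open>finite F\<close> \<open>finite J\<close>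
      by (intro AE_not_in countable_imp_null_set_lborel) (auto intro: countable_finite)
    then show "AE s in lborel. indicator {0..} s *\<^sub>R (p s * h' s) = (\<Sum>j\<in>J. c j * (indicator {0..a j} s *\<^sub>R p s))"
    proof eventually_elim
      case (elim s)
      show ?case
      proof (cases "0 \<le> s")
        case True
        then have "indicator {0..} s *\<^sub>R (p s * h' s) = (\<Sum>j\<in>J. p s * (c j * indicator {..<a j} s))"
          using h elim by (simp add: h'_def sum_distrib_left)
        also have "\<dots> = (\<Sum>j\<in>J. c j * (indicator {0..a j} s *\<^sub>R p s))"
          using True elim by (intro sum.cong) (auto simp: indicator_def)
        finally show ?thesis .
      qed (simp add: sum.neutral)
    qed
  qed measurable
  also have "\<dots> = (\<Sum>j\<in>J. c j * (LINT s:{0..a j}|lborel. p s))"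
    using int unfolding set_integrable_def set_lebesgue_integral_def
    by (subst Bochner_Integration.integral_sum) auto
  finally show ?thesis
    using int by (simp add: set_borel_integral_eq_integral p_def)
qed

text \<open>The chain rule through \<open>\<rho> = 1 / (4 t D)\<close>. The disc formula holds for
  positive diffusivities only, so the derivative is transferred on the open half-line.\<close>

lemma deriv_heat_solution_discs:
  fixes x :: "real^2" and h :: "real \<Rightarrow> real"
  assumes "0 < t" and "0 < D" and "finite J" and "finite F"
    and u0: "\<And>y. u0 y = h (norm y)"
    and h: "\<And>s. 0 \<le> s \<Longrightarrow> s \<notin> F \<Longrightarrow> h s = (\<Sum>j\<in>J. c j * indicator {..<a j} s)"
    and a: "\<And>j. j \<in> J \<Longrightarrow> 0 \<le> a j"
  shows "deriv (\<lambda>D. heat_solution u0 D x t) D =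
    - (1 / (4 * t * D\<^sup>2)) * (\<Sum>j\<in>J. c j * disc_flux (a j) (norm x) (1 / (4 * t * D)))"
proof (rule DERIV_imp_deriv)
  let ?P = "\<lambda>j \<rho>. integral {0..a j} (radial_heat_density (norm x) \<rho>)"
  have "((\<lambda>D. 1 / (4 * (t * D))) has_real_derivative - (1 / (4 * t * D\<^sup>2))) (at D)"
    using assms by (auto intro!: derivative_eq_intros simp: power2_eq_square field_simps)
  then have "((\<lambda>D. ?P j (1 / (4 * (t * D)))) has_real_derivative
      disc_flux (a j) (norm x) (1 / (4 * (t * D))) * - (1 / (4 * t * D\<^sup>2))) (at D)" if "j \<in> J" for j
    using assms that by (intro DERIV_chain2[OF DERIV_integral_radial_heat_density]) auto
  then have "((\<lambda>D. \<Sum>j\<in>J. c j * ?P j (1 / (4 * (t * D)))) has_real_derivative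
      (\<Sum>j\<in>J. c j * (disc_flux (a j) (norm x) (1 / (4 * (t * D))) * - (1 / (4 * t * D\<^sup>2))))) (at D)"
    by (intro DERIV_sum DERIV_cmult) auto
  then have "((\<lambda>D. heat_solution u0 D x t) has_real_derivative
      (\<Sum>j\<in>J. c j * (disc_flux (a j) (norm x) (1 / (4 * (t * D))) * - (1 / (4 * t * D\<^sup>2))))) (at D)"
  proof (rule has_field_derivative_transform_within_open)
    show "open {0::real<..}" by simp
    show "D \<in> {0<..}" using assms by simp
    show "(\<Sum>j\<in>J. c j * ?P j (1 / (4 * (t * D)))) = heat_solution u0 D x t" if "D \<in> {0<..}" for D
      using that \<open>0 < t\<close> by (intro heat_solution_discs[OF _ _ \<open>finite J\<close> \<open>finite F\<close> u0 h, symmetric]) auto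
  qed
  also have "(\<Sum>j\<in>J. c j * (disc_flux (a j) (norm x) (1 / (4 * (t * D))) * - (1 / (4 * t * D\<^sup>2))))
      = - (1 / (4 * t * D\<^sup>2)) * (\<Sum>j\<in>J. c j * disc_flux (a j) (norm x) (1 / (4 * t * D)))"
    by (simp add: sum_distrib_left mult_ac)
  finally show "((\<lambda>D. heat_solution u0 D x t) has_real_derivative
      - (1 / (4 * t * D\<^sup>2)) * (\<Sum>j\<in>J. c j * disc_flux (a j) (norm x) (1 / (4 * t * D)))) (at D)" .
qed

section \<open>Alternating profiles\<close>

lemma sum_alternating_tail:
  "m \<le> N \<Longrightarrow> (\<Sum>j=m..N. (- 1) ^ (N - j)) = (if even (N - m) then 1 else (0::real))"
proof (induction rule: inc_induct)
  case (step n)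
  then have "even (N - n) \<longleftrightarrow> odd (N - Suc n)"
    by (metis Suc_diff_Suc even_Suc)
  with step show ?case
    by (subst sum.atLeast_Suc_atMost) (auto simp: uminus_power_if)
qed simp

text \<open>The discs containing a point at radius \<open>s\<close> have indices
  \<open>{m..N}\<close>, with \<open>m\<close> least such that \<open>s < r m\<close>. Their
  alternating sum is 1 or 0 according to the parity of \<open>N - m\<close>, the same parity that
  selects the interval ending at \<open>r m\<close>.\<close>

lemma alternating_profile_eq_sum:
  assumes g: "alternating_profile N r g" and r: "strict_mono_on {1..N} r"
    and s: "0 \<le> s" "s \<notin> r ` {1..N}"
  shows "g s = (\<Sum>j=1..N. (- 1) ^ (N - j) * indicator {..<r j} s)"
proof -
  let ?J = "{j \<in> {1..N}. s < r j}"
  have sum: "(\<Sum>j=1..N. (- 1) ^ (N - j) * indicator {..<r j} s) = (\<Sum>j\<in>?J. (- 1) ^ (N - j) :: real)"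
    by (auto simp: indicator_def sum.inter_filter intro!: sum.cong)
  have alt: "s \<in> alternating_intervals N r \<longleftrightarrow>
      (\<exists>j\<in>?J. even (N - j) \<and> (j = 1 \<or> r (j - 1) < s))"
    using s by (auto simp: alternating_intervals_def split: if_splits)
  have gs: "g s = (if s \<in> alternating_intervals N r then 1 else 0)"
    using g s by (auto simp: alternating_profile_def)
  show ?thesis
  proof (cases "?J = {}")
    case True
    then show ?thesis unfolding gs alt sum True by simp
  next
    case False
    define m where "m = Min ?J"
    have m: "m \<in> ?J" unfolding m_def using False by (intro Min_in) auto
    have le: "m \<le> j" if "j \<in> ?J" for j unfolding m_def using that by (intro Min_le) auto
    have mono: "r i < r j" if "1 \<le> i" "i < j" "j \<le> N" for i j
      using r that by (auto simp: strict_mono_on_def)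
    have J: "?J = {m..N}"
    proof
      show "{m..N} \<subseteq> ?J"
        using m mono[of m] by (fastforce simp: le_less intro: less_trans)
    qed (use le in auto)
    have "(\<exists>j\<in>?J. even (N - j) \<and> (j = 1 \<or> r (j - 1) < s)) \<longleftrightarrow> even (N - m)"
    proof
      assume "\<exists>j\<in>?J. even (N - j) \<and> (j = 1 \<or> r (j - 1) < s)"
      then obtain j where j: "j \<in> ?J" "even (N - j)" "j = 1 \<or> r (j - 1) < s" by blast
      have "j = m"
      proof (rule ccontr)
        assume "j \<noteq> m"
        then have "m \<le> j - 1" "m < j" using le[OF j(1)] by auto
        then have "j - 1 \<in> ?J" using J j(1) by auto
        with j(3) m \<open>m < j\<close> show False by auto
      qed
      with j show "even (N - m)" by simp
    next
      assume "even (N - m)"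
      moreover have "m = 1 \<or> r (m - 1) < s"
      proof (rule disjCI)
        assume ne: "\<not> r (m - 1) < s"
        show "m = 1"
        proof (rule ccontr)
          assume "m \<noteq> 1"
          then have "m - 1 \<in> {1..N}" "m - 1 < m" using m by auto
          \<comment> \<open>Off the jump radii, failure of \<open>r (m - 1) < s\<close> is strict,
            which contradicts minimality of \<open>m\<close>.\<close>
          moreover from this s ne have "s < r (m - 1)" by force
          ultimately show False using le[of "m - 1"] by auto
        qed
      qed
      ultimately show "\<exists>j\<in>?J. even (N - j) \<and> (j = 1 \<or> r (j - 1) < s)" using m by blast
    qed
    then show ?thesis
      unfolding gs alt sum using m by (subst J) (simp add: sum_alternating_tail)
  qed
qed

section \<open>Square integrability of the flux\<close>

lemma borel_measurable_disc_flux [measurable (raw)]: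
  assumes [measurable]: "f \<in> borel_measurable M" "g \<in> borel_measurable M" "h \<in> borel_measurable M"
  shows "(\<lambda>x. disc_flux (f x) (g x) (h x)) \<in> borel_measurable M"
  unfolding disc_flux_def by measurable

text \<open>Parabolic scaling, used to reduce the ball of radius \<open>R\<close> to the unit
  ball.\<close>

lemma disc_flux_scale: "disc_flux (R * a) (R * q) \<rho> = R\<^sup>2 * disc_flux a q (R\<^sup>2 * \<rho>)"
  by (simp add: disc_flux_def power_mult_distrib power2_eq_square algebra_simps del: One_nat_def)

text \<open>The split \<open>a (a I\<^sub>0 - q I\<^sub>1) = a (a - q) I\<^sub>0 + a q (I\<^sub>0 -
  I\<^sub>1)\<close> isolates the Bessel difference. Its bound gains a factor
  \<open>1 / \<rho>\<close>, and \<open>exp z\<close> from both bounds completes the square in the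
  Gaussian exponent.\<close>

lemma abs_disc_flux_le:
  assumes "0 \<le> a" and "0 \<le> q" and "0 < \<rho>"
  shows "\<bar>disc_flux a q \<rho>\<bar> \<le> (a * \<bar>a - q\<bar> + 1 / (4 * \<rho>)) * exp (- \<rho> * (a - q)\<^sup>2)"
proof -
  define z where "z = 2 * q * a * \<rho>"
  define w where "w = z * (modified_bessel_I 0 z - modified_bessel_I 1 z)"
  have z: "0 \<le> z" using assms by (simp add: z_def)
  have w: "0 \<le> w" "w \<le> exp z / 2" and I: "0 \<le> modified_bessel_I 0 z" "modified_bessel_I 0 z \<le> exp z"
    using bessel_diff_bounds[OF z] modified_bessel_I_nonneg[OF z] by (simp_all add: w_def)
  have "a * (a * modified_bessel_I 0 z - q * modified_bessel_I 1 z)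
      = a * (a - q) * modified_bessel_I 0 z + w / (2 * \<rho>)"
    using assms by (simp add: w_def z_def field_simps del: One_nat_def)
  moreover have "disc_flux a q \<rho> = exp (- \<rho> * (q\<^sup>2 + a\<^sup>2)) * (a * (a * modified_bessel_I 0 z - q * modified_bessel_I 1 z))"
    by (simp only: disc_flux_def z_def mult_ac)
  ultimately have "\<bar>disc_flux a q \<rho>\<bar> = exp (- \<rho> * (q\<^sup>2 + a\<^sup>2)) * \<bar>a * (a - q) * modified_bessel_I 0 z + w / (2 * \<rho>)\<bar>"
    by (simp only: abs_mult[of "exp _"] abs_exp_cancel)
  also have "\<dots> \<le> exp (- \<rho> * (q\<^sup>2 + a\<^sup>2)) * (a * \<bar>a - q\<bar> * exp z + (exp z / 2) / (2 * \<rho>))"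
  proof (intro mult_left_mono order.trans[OF abs_triangle_ineq] add_mono)
    show "\<bar>a * (a - q) * modified_bessel_I 0 z\<bar> \<le> a * \<bar>a - q\<bar> * exp z"
      using I assms by (simp add: abs_mult mult_left_mono)
    have "w / (2 * \<rho>) \<le> exp z / 2 / (2 * \<rho>)"
      using w assms by (intro divide_right_mono) auto
    then show "\<bar>w / (2 * \<rho>)\<bar> \<le> exp z / 2 / (2 * \<rho>)"
      using w assms by simp
  qed simp
  also have "\<dots> = (a * \<bar>a - q\<bar> + 1 / (4 * \<rho>)) * (exp (- \<rho> * (q\<^sup>2 + a\<^sup>2)) * exp z)"
    by (simp add: algebra_simps)
  also have "exp (- \<rho> * (q\<^sup>2 + a\<^sup>2)) * exp z = exp (- \<rho> * (a - q)\<^sup>2)"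
    unfolding mult_exp_exp by (simp add: z_def power2_eq_square algebra_simps)
  finally show ?thesis .
qed

text \<open>The exponential is kept in the first term, where its integral will compensate the factor
  \<open>(a - q)\<^sup>2\<close>. In the second term it may be dropped, since
  \<open>1 / \<rho>\<^sup>2\<close> is integrable at infinity.\<close>

lemma disc_flux_sq_le:
  assumes "0 \<le> a" and "0 \<le> q" and "0 < \<rho>"
  shows "(disc_flux a q \<rho>)\<^sup>2 \<le> 2 * a\<^sup>2 * (a - q)\<^sup>2 * exp (- 2 * (a - q)\<^sup>2 * \<rho>) + 1 / (8 * \<rho>\<^sup>2)"
proof -
  define e where "e = exp (- \<rho> * (a - q)\<^sup>2)"
  have e: "0 \<le> e" "e \<le> 1" "e\<^sup>2 = exp (- 2 * (a - q)\<^sup>2 * \<rho>)"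
    using assms by (simp_all add: e_def flip: exp_double)
  have "(disc_flux a q \<rho>)\<^sup>2 = \<bar>disc_flux a q \<rho>\<bar>\<^sup>2" by simp
  also have "\<dots> \<le> ((a * \<bar>a - q\<bar> + 1 / (4 * \<rho>)) * e)\<^sup>2"
    unfolding e_def by (intro power_mono abs_disc_flux_le assms) simp
  also have "\<dots> = ((a * \<bar>a - q\<bar>) * e + (1 / (4 * \<rho>)) * e)\<^sup>2"
    by (simp add: distrib_right)
  also have "\<dots> \<le> 2 * ((a * \<bar>a - q\<bar>) * e)\<^sup>2 + 2 * ((1 / (4 * \<rho>)) * e)\<^sup>2"
    using sum_squares_bound[of "(a * \<bar>a - q\<bar>) * e" "(1 / (4 * \<rho>)) * e"]
    by (simp add: power2_sum)
  also have "\<dots> \<le> 2 * ((a * \<bar>a - q\<bar>) * e)\<^sup>2 + 2 * ((1 / (4 * \<rho>)) * 1)\<^sup>2"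
    using e assms by (intro add_left_mono mult_left_mono power_mono) auto
  also have "\<dots> = 2 * a\<^sup>2 * (a - q)\<^sup>2 * exp (- 2 * (a - q)\<^sup>2 * \<rho>) + 1 / (8 * \<rho>\<^sup>2)"
    by (simp add: power_mult_distrib power_divide e(3))
  finally show ?thesis .
qed

text \<open>The majorant has the explicit antiderivative \<open>F\<close>, in which the rate
  \<open>b\<close> cancels. The bound is therefore uniform in \<open>q\<close>, including
  \<open>q = a\<close>, where there is no exponential decay.\<close>

lemma disc_flux_sq_integral:
  assumes "0 \<le> a" and "0 \<le> q" and "0 < \<beta>"
  shows "set_integrable lborel {\<beta>..} (\<lambda>\<rho>. (disc_flux a q \<rho>)\<^sup>2)"
    and "(LINT \<rho>:{\<beta>..}|lborel. (disc_flux a q \<rho>)\<^sup>2) \<le> a\<^sup>2 + 1 / (8 * \<beta>)"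
proof -
  define b where "b = 2 * (a - q)\<^sup>2"
  have b: "0 \<le> b" by (simp add: b_def)
  define d where "d \<rho> = a\<^sup>2 * b * exp (- b * \<rho>) + 1 / (8 * \<rho>\<^sup>2)" for \<rho>
  define F where "F \<rho> = - a\<^sup>2 * exp (- b * \<rho>) - 1 / (8 * \<rho>)" for \<rho>
  \<comment> \<open>For \<open>b = 0\<close> the exponential is constantly 1, so \<open>F\<close>
    tends to \<open>- a\<^sup>2\<close> instead of 0.\<close>
  define L where "L = (if b = 0 then - a\<^sup>2 else 0)"
  have "(F \<longlongrightarrow> L) at_top"
  proof (cases "b = 0")
    case True
    have "((\<lambda>\<rho>. - a\<^sup>2 - 1 / (8 * \<rho>)) \<longlongrightarrow> - a\<^sup>2) at_top" by real_asymp
    with True show ?thesis by (simp add: F_def[abs_def] L_def)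
  next
    case False
    with b have "0 < b" by simp
    then have "((\<lambda>\<rho>. - a\<^sup>2 * exp (- b * \<rho>) - 1 / (8 * \<rho>)) \<longlongrightarrow> 0) at_top" by real_asymp
    with False show ?thesis by (simp add: F_def[abs_def] L_def)
  qed
  then have "(\<integral>\<^sup>+\<rho>. ennreal (d \<rho>) * indicator {\<beta>..} \<rho> \<partial>lborel) = L - F \<beta>"
  proof (intro nn_integral_FTC_atLeast)
    show "DERIV F \<rho> :> d \<rho>" if "\<beta> \<le> \<rho>" for \<rho>
      using that assms unfolding F_def d_def
      by (auto intro!: derivative_eq_intros simp: power2_eq_square)
  qed (use b in \<open>auto simp: d_def[abs_def]\<close>)
  also have "ennreal (L - F \<beta>) \<le> ennreal (a\<^sup>2 + 1 / (8 * \<beta>))"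
  proof (rule ennreal_leI)
    have "a\<^sup>2 * exp (- b * \<beta>) \<le> a\<^sup>2 * 1"
      using b assms by (intro mult_left_mono) auto
    then show "L - F \<beta> \<le> a\<^sup>2 + 1 / (8 * \<beta>)" by (simp add: F_def L_def)
  qed
  finally have d: "(\<integral>\<^sup>+\<rho>. ennreal (d \<rho>) * indicator {\<beta>..} \<rho> \<partial>lborel) \<le> ennreal (a\<^sup>2 + 1 / (8 * \<beta>))" .
  have le: "(\<integral>\<^sup>+\<rho>. ennreal (indicator {\<beta>..} \<rho> *\<^sub>R (disc_flux a q \<rho>)\<^sup>2) \<partial>lborel) \<le> ennreal (a\<^sup>2 + 1 / (8 * \<beta>))"
  proof (rule order.trans[OF nn_integral_mono d])
    fix \<rho>
    have "(disc_flux a q \<rho>)\<^sup>2 \<le> d \<rho>" if "\<beta> \<le> \<rho>"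
      using disc_flux_sq_le[of a q \<rho>] assms that by (simp add: d_def b_def mult_ac)
    then show "ennreal (indicator {\<beta>..} \<rho> *\<^sub>R (disc_flux a q \<rho>)\<^sup>2) \<le> ennreal (d \<rho>) * indicator {\<beta>..} \<rho>"
      by (auto simp: indicator_def intro: ennreal_leI)
  qed
  then show int: "set_integrable lborel {\<beta>..} (\<lambda>\<rho>. (disc_flux a q \<rho>)\<^sup>2)"
    unfolding set_integrable_def
    by (intro integrableI_nonneg) (auto simp: le_less_trans)
  have "ennreal (LINT \<rho>:{\<beta>..}|lborel. (disc_flux a q \<rho>)\<^sup>2) \<le> ennreal (a\<^sup>2 + 1 / (8 * \<beta>))"
    using le int unfolding set_lebesgue_integral_def set_integrable_def
    by (subst (asm) nn_integral_eq_integral) auto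
  then show "(LINT \<rho>:{\<beta>..}|lborel. (disc_flux a q \<rho>)\<^sup>2) \<le> a\<^sup>2 + 1 / (8 * \<beta>)"
    using assms by (subst (asm) ennreal_le_iff) auto
qed

text \<open>A product is dominated by the sum of the two squares. The bound, free of
  \<open>q\<close>, is what makes the outer integral over \<open>q\<close> legitimate.\<close>

lemma disc_flux_product_integral:
  assumes "0 \<le> a" and "0 \<le> b" and "0 \<le> q" and "0 < \<beta>"
  shows "set_integrable lborel {\<beta>..} (\<lambda>\<rho>. disc_flux a q \<rho> * disc_flux b q \<rho>)"
    and "\<bar>LINT \<rho>:{\<beta>..}|lborel. disc_flux a q \<rho> * disc_flux b q \<rho>\<bar> \<le> a\<^sup>2 + b\<^sup>2 + 1 / (4 * \<beta>)"
proof -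
  note sq = disc_flux_sq_integral[OF _ \<open>0 \<le> q\<close> \<open>0 < \<beta>\<close>]
  let ?s = "\<lambda>\<rho>. (disc_flux a q \<rho>)\<^sup>2 + (disc_flux b q \<rho>)\<^sup>2"
  have s: "set_integrable lborel {\<beta>..} ?s"
    using sq(1) assms by (intro set_integral_add) auto
  have le: "\<bar>disc_flux a q \<rho> * disc_flux b q \<rho>\<bar> \<le> ?s \<rho>" for \<rho>
  proof -
    have "2 * \<bar>x * y\<bar> \<le> x\<^sup>2 + y\<^sup>2" for x y :: real
      using sum_squares_bound[of "\<bar>x\<bar>" "\<bar>y\<bar>"] by (simp add: abs_mult)
    from this[of "disc_flux a q \<rho>" "disc_flux b q \<rho>"] show ?thesis by linarith
  qed
  show int: "set_integrable lborel {\<beta>..} (\<lambda>\<rho>. disc_flux a q \<rho> * disc_flux b q \<rho>)"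
  proof (rule set_integrable_bound[OF s])
    show "set_borel_measurable lborel {\<beta>..} (\<lambda>\<rho>. disc_flux a q \<rho> * disc_flux b q \<rho>)"
      unfolding set_borel_measurable_def by measurable
    show "AE \<rho> in lborel. \<rho> \<in> {\<beta>..} \<longrightarrow> norm (disc_flux a q \<rho> * disc_flux b q \<rho>) \<le> norm (?s \<rho>)"
      using le by (auto intro!: AE_I2 intro: order.trans[OF _ abs_ge_self])
  qed
  have "\<bar>LINT \<rho>:{\<beta>..}|lborel. disc_flux a q \<rho> * disc_flux b q \<rho>\<bar>
      \<le> (LINT \<rho>:{\<beta>..}|lborel. \<bar>disc_flux a q \<rho> * disc_flux b q \<rho>\<bar>)"
    using set_integral_norm_bound[OF int] by simp
  also have "\<dots> \<le> (LINT \<rho>:{\<beta>..}|lborel. ?s \<rho>)"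
    using le by (intro set_integral_mono s set_integrable_abs int) auto
  also have "\<dots> = (LINT \<rho>:{\<beta>..}|lborel. (disc_flux a q \<rho>)\<^sup>2) + (LINT \<rho>:{\<beta>..}|lborel. (disc_flux b q \<rho>)\<^sup>2)"
    using sq(1) assms by (intro set_integral_add) auto
  also have "\<dots> \<le> (a\<^sup>2 + 1 / (8 * \<beta>)) + (b\<^sup>2 + 1 / (8 * \<beta>))"
    using sq(2) assms by (intro add_mono) auto
  finally show "\<bar>LINT \<rho>:{\<beta>..}|lborel. disc_flux a q \<rho> * disc_flux b q \<rho>\<bar> \<le> a\<^sup>2 + b\<^sup>2 + 1 / (4 * \<beta>)"
    by simp
qed

section \<open>Termwise integration of the squared flux sum\<close>

lemma sensitivity_kernel_disc_flux:
  "sensitivity_kernel \<beta> r s =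
    (LINT q:{0..1}|lborel. q * (LINT \<rho>:{\<beta>..}|lborel. disc_flux r q \<rho> * disc_flux s q \<rho>))"
proof -
  have "exp (- \<rho> * (q\<^sup>2 + r\<^sup>2 + q\<^sup>2 + s\<^sup>2))
        * (r * modified_bessel_I 0 (2 * q * r * \<rho>) - q * modified_bessel_I 1 (2 * q * r * \<rho>))
        * (s * modified_bessel_I 0 (2 * q * s * \<rho>) - q * modified_bessel_I 1 (2 * q * s * \<rho>))
        * r * s = disc_flux r q \<rho> * disc_flux s q \<rho>" for q \<rho>
  proof -
    have "exp (- \<rho> * (q\<^sup>2 + r\<^sup>2 + q\<^sup>2 + s\<^sup>2)) = exp (- \<rho> * (q\<^sup>2 + r\<^sup>2)) * exp (- \<rho> * (q\<^sup>2 + s\<^sup>2))"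
      by (simp add: mult_exp_exp algebra_simps)
    then show ?thesis by (simp only: disc_flux_def mult_ac)
  qed
  then show ?thesis by (simp only: sensitivity_kernel_def)
qed

lemma set_integral_double_sum:
  fixes f :: "'i \<Rightarrow> 'j \<Rightarrow> 'a \<Rightarrow> real"
  assumes "\<And>j k. j \<in> J \<Longrightarrow> k \<in> K \<Longrightarrow> set_integrable M A (f j k)"
  shows "set_integrable M A (\<lambda>x. \<Sum>j\<in>J. \<Sum>k\<in>K. c j k * f j k x)"
    and "(LINT x:A|M. (\<Sum>j\<in>J. \<Sum>k\<in>K. c j k * f j k x)) = (\<Sum>j\<in>J. \<Sum>k\<in>K. c j k * (LINT x:A|M. f j k x))"
proof -
  have eq: "indicator A x *\<^sub>R (\<Sum>j\<in>J. \<Sum>k\<in>K. c j k * f j k x)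
      = (\<Sum>j\<in>J. \<Sum>k\<in>K. c j k * (indicator A x *\<^sub>R f j k x))" for x
    by (simp add: sum_distrib_left mult_ac)
  show "set_integrable M A (\<lambda>x. \<Sum>j\<in>J. \<Sum>k\<in>K. c j k * f j k x)"
    using assms unfolding set_integrable_def eq
    by (intro Bochner_Integration.integrable_sum integrable_mult_right) auto
  show "(LINT x:A|M. (\<Sum>j\<in>J. \<Sum>k\<in>K. c j k * f j k x)) = (\<Sum>j\<in>J. \<Sum>k\<in>K. c j k * (LINT x:A|M. f j k x))"
    using assms unfolding set_integrable_def set_lebesgue_integral_def eq
    by (simp add: Bochner_Integration.integral_sum)
qed

text \<open>After expanding the square, the finite sums pass through both integrals: the inner one
  by integrability of the products, the outer one because its integrand is measurable and bounded on
  \<open>{0..1}\<close>.\<close>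

lemma integral_flux_sum_sq:
  assumes a: "\<And>j. j \<in> J \<Longrightarrow> 0 \<le> a j" and "0 < \<beta>"
  shows "(LINT q:{0..1}|lborel. q * (LINT \<rho>:{\<beta>..}|lborel. (\<Sum>j\<in>J. c j * disc_flux (a j) q \<rho>)\<^sup>2))
    = (\<Sum>j\<in>J. \<Sum>k\<in>J. c j * c k * sensitivity_kernel \<beta> (a j) (a k))"
    and "\<And>q. 0 \<le> q \<Longrightarrow> set_integrable lborel {\<beta>..} (\<lambda>\<rho>. (\<Sum>j\<in>J. c j * disc_flux (a j) q \<rho>)\<^sup>2)"
proof -
  define K where "K a b q = (LINT \<rho>:{\<beta>..}|lborel. disc_flux a q \<rho> * disc_flux b q \<rho>)" for a b q
  have sq: "(\<Sum>j\<in>J. c j * disc_flux (a j) q \<rho>)\<^sup>2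
      = (\<Sum>j\<in>J. \<Sum>k\<in>J. c j * c k * (disc_flux (a j) q \<rho> * disc_flux (a k) q \<rho>))" for q \<rho>
    unfolding power2_eq_square sum_product by (intro sum.cong refl) (simp only: mult_ac)
  have int: "set_integrable lborel {\<beta>..} (\<lambda>\<rho>. disc_flux (a j) q \<rho> * disc_flux (a k) q \<rho>)"
    if "j \<in> J" "k \<in> J" "0 \<le> q" for j k q
    using that assms by (intro disc_flux_product_integral) auto
  show "set_integrable lborel {\<beta>..} (\<lambda>\<rho>. (\<Sum>j\<in>J. c j * disc_flux (a j) q \<rho>)\<^sup>2)" if "0 \<le> q" for q
    unfolding sq using int that by (intro set_integral_double_sum) auto
  have inner: "(LINT \<rho>:{\<beta>..}|lborel. (\<Sum>j\<in>J. c j * disc_flux (a j) q \<rho>)\<^sup>2)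
      = (\<Sum>j\<in>J. \<Sum>k\<in>J. c j * c k * K (a j) (a k) q)" if "0 \<le> q" for q
    unfolding sq K_def using int that by (intro set_integral_double_sum) auto
  have meas [measurable]: "K b b' \<in> borel_measurable borel" for b b'
    unfolding K_def set_lebesgue_integral_def by measurable
  have outer: "set_integrable lborel {0..1} (\<lambda>q. q * K (a j) (a k) q)" if "j \<in> J" "k \<in> J" for j k
    unfolding set_integrable_def
  proof (rule integrableI_bounded_set_indicator[where B = "(a j)\<^sup>2 + (a k)\<^sup>2 + 1 / (4 * \<beta>)"])
    have "\<bar>q * K (a j) (a k) q\<bar> \<le> 1 * ((a j)\<^sup>2 + (a k)\<^sup>2 + 1 / (4 * \<beta>))" if "q \<in> {0..1}" for q
      unfolding abs_mult K_def using that a \<open>j \<in> J\<close> \<open>k \<in> J\<close> \<open>0 < \<beta>\<close>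
      by (intro mult_mono disc_flux_product_integral) auto
    then show "AE q in lborel. q \<in> {0..1} \<longrightarrow> norm (q * K (a j) (a k) q) \<le> (a j)\<^sup>2 + (a k)\<^sup>2 + 1 / (4 * \<beta>)"
      by auto
  qed auto
  have "(LINT q:{0..1}|lborel. q * (LINT \<rho>:{\<beta>..}|lborel. (\<Sum>j\<in>J. c j * disc_flux (a j) q \<rho>)\<^sup>2))
      = (LINT q:{0..1}|lborel. (\<Sum>j\<in>J. \<Sum>k\<in>J. c j * c k * (q * K (a j) (a k) q)))"
    by (intro set_lebesgue_integral_cong) (auto simp: inner sum_distrib_left mult_ac)
  also have "\<dots> = (\<Sum>j\<in>J. \<Sum>k\<in>J. c j * c k * (LINT q:{0..1}|lborel. q * K (a j) (a k) q))"
    using outer by (intro set_integral_double_sum) auto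
  finally show "(LINT q:{0..1}|lborel. q * (LINT \<rho>:{\<beta>..}|lborel. (\<Sum>j\<in>J. c j * disc_flux (a j) q \<rho>)\<^sup>2))
    = (\<Sum>j\<in>J. \<Sum>k\<in>J. c j * c k * sensitivity_kernel \<beta> (a j) (a k))"
    unfolding K_def sensitivity_kernel_disc_flux .
qed

section \<open>Changes of variable in time and radius\<close>

text \<open>The decreasing substitution \<open>t = c / \<rho>\<close>, performed as \<open>t = - c / p\<close> with \<open>p = - \<rho>\<close>
  because the library rule wants an increasing one.\<close>

lemma LINT_inverse_substitution:
  fixes f :: "real \<Rightarrow> real"
  assumes "0 < c" and "0 < T" and cont: "continuous_on UNIV f" and nonneg: "\<And>\<rho>. 0 \<le> f \<rho>"
    and int: "set_integrable lborel {c / T..} f"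
  shows "(LINT t:{0..T}|lborel. (c / t)\<^sup>2 * f (c / t)) = c * (LINT \<rho>:{c / T..}|lborel. f \<rho>)"
proof -
  define \<beta> where "\<beta> = c / T"
  have \<beta>: "0 < \<beta>" using assms by (simp add: \<beta>_def)
  let ?F = "\<lambda>t. (c / t)\<^sup>2 * f (c / t)"
  let ?g = "\<lambda>p. - c / p" and ?g' = "\<lambda>p. c / p\<^sup>2"
  \<comment> \<open>At \<open>t = - c / p\<close> the weight \<open>(c / t)\<^sup>2\<close> is
    \<open>p\<^sup>2\<close> and cancels the Jacobian \<open>c / p\<^sup>2\<close> up to the
    constant \<open>c\<close>.\<close>
  have Fg: "?F (?g p) * ?g' p = c * f (- p)" if "p < 0" for p
    using that assms by (simp add: field_simps power2_eq_square)
  have neg: "p < 0" if "ereal p < ereal (- \<beta>)" for p using that \<beta> by simp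
  have isf: "isCont f x" for x using cont by (simp add: continuous_on_eq_continuous_at)
  have refl_int: "set_integrable lborel {..<- \<beta>} (\<lambda>p. c * f (- p))"
  proof -
    have "set_integrable lborel {\<beta><..} f"
      using int by (rule set_integrable_subset) (auto simp: \<beta>_def)
    then have "integrable lborel (\<lambda>p. indicator {\<beta><..} (0 + - 1 * p) *\<^sub>R f (0 + - 1 * p))"
      unfolding set_integrable_def by (rule lborel_integrable_real_affine) simp
    also have "(\<lambda>p. indicator {\<beta><..} (0 + - 1 * p) *\<^sub>R f (0 + - 1 * p)) = (\<lambda>p. indicator {..<- \<beta>} p *\<^sub>R f (- p))"
      by (auto simp: fun_eq_iff indicator_def)
    finally show ?thesis by (intro set_integrable_mult_right) (simp add: set_integrable_def)
  qed
  \<comment> \<open>The endpoint \<open>t = 0\<close> corresponds to \<open>p\<close> tending to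
    minus infinity, and \<open>t = T\<close> to \<open>p = - \<beta>\<close>.\<close>
  have "(LBINT t=0..ereal T. ?F t) = (LBINT p=-\<infinity>..ereal (- \<beta>). ?F (?g p) * ?g' p)"
  proof (rule interval_integral_substitution_nonneg(2))
    show "DERIV ?g p :> ?g' p" if "ereal p < ereal (- \<beta>)" for p
      using neg[OF that] by (auto intro!: derivative_eq_intros simp: power2_eq_square)
    show "isCont ?F (?g p)" if "ereal p < ereal (- \<beta>)" for p
      using neg[OF that] assms
      by (intro continuous_intros isCont_o2[OF _ isf]) auto
    show "isCont ?g' p" if "ereal p < ereal (- \<beta>)" for p
      using neg[OF that] by (intro continuous_intros) auto
    show "((ereal \<circ> ?g \<circ> real_of_ereal) \<longlongrightarrow> 0) (at_right (- \<infinity>))"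
    proof -
      have "((\<lambda>p. - c / p) \<longlongrightarrow> 0) at_bot" by real_asymp
      then show ?thesis by (simp add: ereal_tendsto_simps comp_assoc zero_ereal_def)
    qed
    show "((ereal \<circ> ?g \<circ> real_of_ereal) \<longlongrightarrow> ereal T) (at_left (ereal (- \<beta>)))"
    proof -
      have "isCont ?g (- \<beta>)" using \<beta> by (intro continuous_intros) auto
      then have "(?g \<longlongrightarrow> ?g (- \<beta>)) (at_left (- \<beta>))"
        by (auto simp: isCont_def intro: filterlim_mono at_le)
      moreover have "?g (- \<beta>) = T" using assms by (simp add: \<beta>_def)
      ultimately show ?thesis by (simp add: ereal_tendsto_simps comp_assoc)
    qed
    have "set_integrable lborel {..<- \<beta>} (\<lambda>p. ?F (?g p) * ?g' p)"
      using refl_int by (rule set_integrable_cong[THEN iffD1, rotated -1]) (use \<beta> Fg in auto)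
    then show "set_integrable lborel (einterval (- \<infinity>) (ereal (- \<beta>))) (\<lambda>p. ?F (?g p) * ?g' p)"
      by (simp add: einterval_def lessThan_def)
  qed (use assms in \<open>auto intro: mult_nonneg_nonneg\<close>)
  also have "\<dots> = (LBINT p=-\<infinity>..ereal (- \<beta>). c * f (- p))"
    using Fg neg by (intro interval_integral_cong) (auto simp: einterval_def)
  also have "\<dots> = (LBINT \<rho>=ereal \<beta>..\<infinity>. c * f \<rho>)"
    by (subst interval_integral_reflect) simp
  also have "\<dots> = c * (LINT \<rho>:{\<beta>..}|lborel. f \<rho>)"
  proof -
    have "(LBINT \<rho>=ereal \<beta>..\<infinity>. f \<rho>) = (LINT \<rho>:{\<beta>..}|lborel. f \<rho>)"
      unfolding interval_integral_to_infinity_eq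
      by (rule set_integral_discrete_difference[where X = "{\<beta>}"]) auto
    then show ?thesis by simp
  qed
  finally show ?thesis
    using assms by (simp add: \<beta>_def interval_integral_Icc zero_ereal_def)
qed

lemma LINT_Icc_scale:
  fixes f :: "real \<Rightarrow> real"
  assumes "0 < R"
  shows "(LINT q:{0..R}|lborel. f q) = R * (LINT q:{0..1}|lborel. f (R * q))"
proof -
  have "(LINT q:{0..R}|lborel. f q) = \<bar>R\<bar> *\<^sub>R (\<integral>q. indicator {0..R} (0 + R * q) *\<^sub>R f (0 + R * q) \<partial>lborel)"
    unfolding set_lebesgue_integral_def using assms by (intro lborel_integral_real_affine) auto
  also have "(\<integral>q. indicator {0..R} (0 + R * q) *\<^sub>R f (0 + R * q) \<partial>lborel) = (LINT q:{0..1}|lborel. f (R * q))"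
    unfolding set_lebesgue_integral_def using assms
    by (intro Bochner_Integration.integral_cong) (auto simp: indicator_def zero_le_mult_iff mult_le_cancel_left1)
  finally show ?thesis using assms by simp
qed

section \<open>Assembly of the sensitivity formula\<close>

theorem proposition3p4:
  fixes R T D \<beta> :: real and N :: nat and r :: "nat \<Rightarrow> real"
    and g :: "real \<Rightarrow> real" and v0 u0 :: "real^2 \<Rightarrow> real"
  assumes "R > 0" and "T > 0" and "D > 0"
    and "\<beta> = R\<^sup>2 / (4 * T * D)"
    and "N \<ge> 1"
    and "0 \<le> r 1" and "strict_mono_on {1..N} r"
    and "alternating_profile N r g"
    and "\<And>z. v0 z = g (norm z)"
    and "\<And>x. u0 x = v0 (x /\<^sub>R R)"
  shows "sensitivity u0 D R T =
    T ^ 3 / R\<^sup>2 * 32 * pi * \<beta> ^ 3 *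
      (\<Sum>j=1..N. \<Sum>k=1..N. (- 1) ^ (k + j) * sensitivity_kernel \<beta> (r j) (r k))"
proof -
  \<comment> \<open>Signs are counted from the outermost radius, which always carries a plus
    sign.\<close>
  define c :: "nat \<Rightarrow> real" where "c j = (- 1) ^ (N - j)" for j
  define f where "f q \<rho> = (\<Sum>j=1..N. c j * disc_flux (r j) q \<rho>)\<^sup>2" for q \<rho>
  have f_nonneg: "0 \<le> f q \<rho>" for q \<rho> by (simp add: f_def)
  define \<Phi> where "\<Phi> q = (LINT \<rho>:{\<beta>..}|lborel. f q \<rho>)" for q
  \<comment> \<open>After rescaling lengths by \<open>R\<close>, the variable
    \<open>1 / (4 t D)\<close> becomes \<open>\<kappa> / t\<close>, which equals
    \<open>\<beta>\<close> at \<open>t = T\<close>.\<close>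
  define \<kappa> where "\<kappa> = R\<^sup>2 / (4 * D)"
  have \<kappa>: "0 < \<kappa>" "\<kappa> / T = \<beta>" and \<beta>: "0 < \<beta>"
    using assms by (simp_all add: \<kappa>_def mult_ac)
  have r: "0 \<le> r j" if "j \<in> {1..N}" for j
  proof (cases "j = 1")
    case False
    then have "r 1 < r j"
      using that \<open>strict_mono_on {1..N} r\<close> by (auto simp: strict_mono_on_def)
    with \<open>0 \<le> r 1\<close> show ?thesis by simp
  qed (use \<open>0 \<le> r 1\<close> in simp)
  have g: "g (s / R) = (\<Sum>j=1..N. c j * indicator {..<R * r j} s)"
    if "0 \<le> s" "s \<notin> (\<lambda>j. R * r j) ` {1..N}" for s
  proof -
    have "s / R \<notin> r ` {1..N}"
    proof
      assume "s / R \<in> r ` {1..N}"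
      then obtain j where "j \<in> {1..N}" "s = R * r j"
        using \<open>R > 0\<close> by (auto simp: field_simps)
      with that show False by blast
    qed
    then have "g (s / R) = (\<Sum>j=1..N. c j * indicator {..<r j} (s / R))"
      unfolding c_def using that \<open>R > 0\<close> by (intro alternating_profile_eq_sum assms) auto
    also have "\<dots> = (\<Sum>j=1..N. c j * indicator {..<R * r j} s)"
      using \<open>R > 0\<close> by (intro sum.cong) (auto simp: indicator_def field_simps)
    finally show ?thesis .
  qed
  have u0: "u0 y = g (norm y / R)" for y
    using \<open>R > 0\<close> by (simp add: assms(9,10) divide_inverse_commute)
  have deriv_sq: "\<bar>deriv (\<lambda>D. heat_solution u0 D x t) D\<bar>\<^sup>2 = (1 / D\<^sup>2) * ((\<kappa> / t)\<^sup>2 * f (norm x / R) (\<kappa> / t))"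
    if "0 \<le> t" for x t
  proof (cases "t = 0")
    \<comment> \<open>At time 0 the solution does not depend on the diffusivity, so the derivative
      is 0; the right-hand side agrees because \<open>\<kappa> / 0 = 0\<close>.\<close>
    case True
    then show ?thesis by (simp add: heat_solution_def)
  next
    case False
    with that have t: "0 < t" by simp
    have "deriv (\<lambda>D. heat_solution u0 D x t) D
        = - (1 / (4 * t * D\<^sup>2)) * (\<Sum>j=1..N. c j * disc_flux (R * r j) (norm x) (1 / (4 * t * D)))"
      using r \<open>R > 0\<close> by (intro deriv_heat_solution_discs[OF t \<open>D > 0\<close> _ _ u0 g]) auto
    also have "(\<Sum>j=1..N. c j * disc_flux (R * r j) (norm x) (1 / (4 * t * D)))
        = R\<^sup>2 * (\<Sum>j=1..N. c j * disc_flux (r j) (norm x / R) (\<kappa> / t))"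
    proof -
      have "disc_flux (R * r j) (norm x) (1 / (4 * t * D)) = R\<^sup>2 * disc_flux (r j) (norm x / R) (\<kappa> / t)" for j
        using disc_flux_scale[of R "r j" "norm x / R" "1 / (4 * t * D)"] \<open>R > 0\<close>
        by (simp add: \<kappa>_def mult_ac)
      then show ?thesis by (simp add: sum_distrib_left mult_ac)
    qed
    also have "- (1 / (4 * t * D\<^sup>2)) * (R\<^sup>2 * S) = - (1 / D * (\<kappa> / t)) * S" for S
      by (simp add: \<kappa>_def power2_eq_square)
    finally show ?thesis
      by (simp only: power2_abs power2_minus power_mult_distrib power_one_over f_def mult_minus_left mult.assoc)
  qed
  have inner: "(LINT t:{0..T}|lborel. \<bar>deriv (\<lambda>D. heat_solution u0 D x t) D\<bar>\<^sup>2)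
      = \<kappa> / D\<^sup>2 * \<Phi> (norm x / R)" for x
  proof -
    have "(LINT t:{0..T}|lborel. \<bar>deriv (\<lambda>D. heat_solution u0 D x t) D\<bar>\<^sup>2)
        = (LINT t:{0..T}|lborel. (1 / D\<^sup>2) * ((\<kappa> / t)\<^sup>2 * f (norm x / R) (\<kappa> / t)))"
      by (intro set_lebesgue_integral_cong allI impI deriv_sq) simp_all
    also have "\<dots> = (1 / D\<^sup>2) * (LINT t:{0..T}|lborel. (\<kappa> / t)\<^sup>2 * f (norm x / R) (\<kappa> / t))"
      by (rule set_integral_mult_right)
    also have "(LINT t:{0..T}|lborel. (\<kappa> / t)\<^sup>2 * f (norm x / R) (\<kappa> / t)) = \<kappa> * \<Phi> (norm x / R)"
    proof -
      have "set_integrable lborel {\<kappa> / T..} (f (norm x / R))"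
        unfolding \<kappa>(2) f_def using r \<beta> \<open>R > 0\<close> by (intro integral_flux_sum_sq(2)) auto
      moreover have "continuous_on UNIV (f (norm x / R))"
        unfolding f_def by (intro continuous_intros)
      ultimately have "(LINT t:{0..T}|lborel. (\<kappa> / t)\<^sup>2 * f (norm x / R) (\<kappa> / t))
          = \<kappa> * (LINT \<rho>:{\<kappa> / T..}|lborel. f (norm x / R) \<rho>)"
        using \<kappa> \<open>T > 0\<close> by (intro LINT_inverse_substitution) (simp_all add: f_nonneg)
      then show ?thesis by (simp add: \<Phi>_def \<kappa>(2))
    qed
    finally show ?thesis by simp
  qed
  have [measurable]: "\<Phi> \<in> borel_measurable borel"
    unfolding \<Phi>_def f_def set_lebesgue_integral_def by measurable
  have "sensitivity u0 D R T = (LINT x:cball (0 :: real^2) R|lborel. \<kappa> / D\<^sup>2 * \<Phi> (norm x / R))"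
    by (simp only: sensitivity_def inner)
  also have "\<dots> = (LINT q:{0..R}|lborel. 2 * pi * q * (\<kappa> / D\<^sup>2 * \<Phi> (q / R)))"
    by (rule LINT_cball_radial) measurable
  also have "\<dots> = R * (LINT q:{0..1}|lborel. 2 * pi * (R * q) * (\<kappa> / D\<^sup>2 * \<Phi> (R * q / R)))"
    using \<open>R > 0\<close> by (rule LINT_Icc_scale)
  also have "(LINT q:{0..1}|lborel. 2 * pi * (R * q) * (\<kappa> / D\<^sup>2 * \<Phi> (R * q / R)))
      = (LINT q:{0..1}|lborel. (2 * pi * R * \<kappa> / D\<^sup>2) * (q * \<Phi> q))"
    using \<open>R > 0\<close> by (intro set_lebesgue_integral_cong) auto
  also have "\<dots> = (2 * pi * R * \<kappa> / D\<^sup>2) * (LINT q:{0..1}|lborel. q * \<Phi> q)"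
    by (rule set_integral_mult_right)
  also have "(LINT q:{0..1}|lborel. q * \<Phi> q)
      = (\<Sum>j=1..N. \<Sum>k=1..N. c j * c k * sensitivity_kernel \<beta> (r j) (r k))"
    unfolding \<Phi>_def f_def using r \<beta> by (rule integral_flux_sum_sq(1))
  also have "\<dots> = (\<Sum>j=1..N. \<Sum>k=1..N. (- 1) ^ (k + j) * sensitivity_kernel \<beta> (r j) (r k))"
  proof (intro sum.cong refl)
    fix j k assume jk: "j \<in> {1..N}" "k \<in> {1..N}"
    \<comment> \<open>Since \<open>j\<close> and \<open>k\<close> are at most \<open>N\<close>, the
      subtractions are exact and \<open>2 * N\<close> drops out of the parity.\<close>
    then have "even (N - j + (N - k)) \<longleftrightarrow> even (k + j)" by auto
    then have "c j * c k = (- 1) ^ (k + j)"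
      unfolding c_def power_add[symmetric] by (simp add: minus_one_power_iff)
    then show "c j * c k * sensitivity_kernel \<beta> (r j) (r k) = (- 1) ^ (k + j) * sensitivity_kernel \<beta> (r j) (r k)"
      by simp
  qed
  finally have "sensitivity u0 D R T = R * (2 * pi * R * \<kappa> / D\<^sup>2) *
      (\<Sum>j=1..N. \<Sum>k=1..N. (- 1) ^ (k + j) * sensitivity_kernel \<beta> (r j) (r k))"
    by (simp only: mult.assoc)
  \<comment> \<open>Both constants equal \<open>pi * R ^ 4 / (2 * D ^ 3)\<close>.\<close>
  also have "R * (2 * pi * R * \<kappa> / D\<^sup>2) = T ^ 3 / R\<^sup>2 * 32 * pi * \<beta> ^ 3"
    using assms(1-3) unfolding assms(4) \<kappa>_def
    by (simp add: field_simps power2_eq_square power3_eq_cube)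
  finally show ?thesis .
qed

end
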